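(* Let $N=\langle P,T,\mathrm{Pre},\mathrm{Post},m_0,\mathbf{I}_s,\mathbf{I}_d\rangle$ be a weak Dynamic Time Petri Net (i.e. its dynamic interval function is trivial: $\mathbf{I}_d(t,m,\theta)=[\theta,\theta]$ for all $t,m,\theta$) whose set of reachable markings is finite. Then there exists a (standard) Time Petri Net $N^\times$ whose semantics is equivalent to that of $N$, i.e. the state graph of $N$ and the state graph of $N^\times$ are weakly timed bisimilar.
   Context: Let $\mathbb{I}$ be the set of real intervals of the form $[a,b]$ or $[a,+\infty)$ with non-negative rational endpoints. A Dynamic Time Petri Net (DTPN) is a tuple $\langle P,T,\mathrm{Pre},\mathrm{Post},m_0,\mathbf{I}_s,\mathbf{I}_d\rangle$ where $P,T$ are finite sets of places and transitions, $\mathrm{Pre},\mathrm{Post}:T\to P\to\mathbb{N}$, $m_0:P\to\mathbb{N}$ is the initial marking, $\mathbf{I}_s:T\to(P\to\mathbb{N})\to\mathbb{I}$ is the static interval function and $\mathbf{I}_d:T\to(P\to\mathbb{N})\to\mathbb{R}_{\ge0}\to\mathbb{I}$ is the dynamic interval function. A transition $t$ is enabled at marking $m$ if $m\ge\mathrm{Pre}(t)$ pointwise; $\mathcal{E}(m)$ is the set of enabled transitions. For $t\in\mathcal{E}(m)$ let $\mathrm{pers}(m,t)=\{k\in\mathcal{E}(m)\setminus\{t\}\mid m-\mathrm{Pre}(t)\ge\mathrm{Pre}(k)\}$ (persistent transitions). A state is a pair $(m,\varphi)$ with $m$ a marking and $\varphi:\mathcal{E}(m)\to\mathbb{R}_{\ge0}$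 (firing dates). The state graph is the timed transition system whose initial states are $(m_0,\varphi)$ with $\varphi(t)\in\mathbf{I}_s(t,m_0)$ for all $t\in\mathcal{E}(m_0)$, and whose transitions are: (i) if $t\in\mathcal{E}(m)$ and $\varphi(t)=0$ then $(m,\varphi)\xrightarrow{t}(m',\varphi')$ where $m'=m-\mathrm{Pre}(t)+\mathrm{Post}(t)$, $\varphi'(k)\in\mathbf{I}_d(k,m',\varphi(k))$ for every $k\in\mathrm{pers}(m,t)$, and $\varphi'(k)\in\mathbf{I}_s(k,m')$ for every other $k\in\mathcal{E}(m')$; (ii) for $\theta\in\mathbb{R}_{\ge0}$ with $\theta\le\varphi(k)$ for all $k\in\mathcal{E}(m)$, $(m,\varphi)\xrightarrow{\theta}(m,\varphi-\theta)$. A (standard) Time Petri Net is a DTPN in which $\mathbf{I}_s(t,m)$ does not depend on $m$ and $\mathbf{I}_d$ is trivial. Weak timed bisimilarity: the transitions of $N^\times$ are labelled by transitions of $N$ or by a silent label $\tau$; writing $\Rightarrow^{\alpha}$ for $(\xrightarrow{\tau})^*\xrightarrow{\alpha}$ if $\alpha\neq\tau$ and $(\xrightarrow{\tau})^*$ otherwise, a relation $R$ between states of two timed transition systems is a weak timed simulation if whenever $s_1\xrightarrow{\alpha}s_1'$ and $s_1 R s_2$ there is $s_2'$ with $s_2\Rightarrow^{\alpha}s_2'$ and $s_1' R s_2'$; the systems are weakly timed bisimilar if there is $R$ such that $R$ and $R^{-1}$ are weak timed simulations. *)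

theory Defs
  imports Complex_Main "HOL-Library.FuncSet"
begin

datatype 'a tlabel = Tau | Act 'a | Delay real

record ('s, 'a) tts =
  states :: "'s set"
  init :: "'s set"
  step :: "'s \<Rightarrow> 'a tlabel \<Rightarrow> 's \<Rightarrow> bool"

definition wstep :: "('s, 'a) tts \<Rightarrow> 's \<Rightarrow> 'a tlabel \<Rightarrow> 's \<Rightarrow> bool" where
  "wstep A s \<alpha> s' \<longleftrightarrow>
     (if \<alpha> = Tau then (\<lambda>u v. step A u Tau v)\<^sup>*\<^sup>* s s'
      else \<exists>u. (\<lambda>u v. step A u Tau v)\<^sup>*\<^sup>* s u \<and> step A u \<alpha> s')"

definition weak_timed_simulation ::
  "('s, 'a) tts \<Rightarrow> ('r, 'a) tts \<Rightarrow> ('s \<times> 'r) set \<Rightarrow> bool" where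
  "weak_timed_simulation A B R \<longleftrightarrow>
     (\<forall>s1 s2 \<alpha> s1'. (s1, s2) \<in> R \<longrightarrow> step A s1 \<alpha> s1' \<longrightarrow>
        (\<exists>s2'. wstep B s2 \<alpha> s2' \<and> (s1', s2') \<in> R))"

text \<open>The relation has to match the initial states of the two systems; without this
  requirement the empty relation would make any two systems bisimilar.\<close>

definition weakly_timed_bisimilar :: "('s, 'a) tts \<Rightarrow> ('r, 'a) tts \<Rightarrow> bool" where
  "weakly_timed_bisimilar A B \<longleftrightarrow>
     (\<exists>R. R \<subseteq> states A \<times> states B \<and>
          weak_timed_simulation A B R \<and>
          weak_timed_simulation B A (R\<inverse>) \<and>
          (\<forall>s1\<in>init A. \<exists>s2\<in>init B. (s1, s2) \<in> R) \<and>
          (\<forall>s2\<in>init B. \<exists>s1\<in>init A. (s1, s2) \<in> R))"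

definition reachable :: "('s, 'a) tts \<Rightarrow> 's set" where
  "reachable A = {s'. \<exists>s\<in>init A. (\<lambda>u v. \<exists>\<alpha>. step A u \<alpha> v)\<^sup>*\<^sup>* s s'}"

definition rat_intervals :: "real set set" where
  "rat_intervals =
     {{a..b} | a b. a \<in> \<rat> \<and> b \<in> \<rat> \<and> 0 \<le> a \<and> a \<le> b} \<union> {{a..} | a. a \<in> \<rat> \<and> 0 \<le> a}"

definition real_intervals :: "real set set" where
  "real_intervals = {{a..b} | a b. 0 \<le> a \<and> a \<le> b} \<union> {{a..} | a. 0 \<le> a}"

record ('p, 't) dtpn =
  places :: "'p set"
  transitions :: "'t set"
  Pre :: "'t \<Rightarrow> 'p \<Rightarrow> nat"
  Post :: "'t \<Rightarrow> 'p \<Rightarrow> nat"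
  m0 :: "'p \<Rightarrow> nat"
  Is :: "'t \<Rightarrow> ('p \<Rightarrow> nat) \<Rightarrow> real set"
  Id :: "'t \<Rightarrow> ('p \<Rightarrow> nat) \<Rightarrow> real \<Rightarrow> real set"

text \<open>Markings and firing-date functions are partial functions, with domain the set of
  places and the set of enabled transitions respectively, encoded as extensional functions.\<close>

definition markings :: "('p, 't) dtpn \<Rightarrow> ('p \<Rightarrow> nat) set" where
  "markings N = places N \<rightarrow>\<^sub>E UNIV"

text \<open>Static intervals have rational endpoints. Dynamic intervals may have real endpoints:
  the trivial dynamic interval \<open>{\<theta>..\<theta>}\<close> is not a rational interval when \<open>\<theta>\<close> is irrational.\<close>

definition is_dtpn :: "('p, 't) dtpn \<Rightarrow> bool" where
  "is_dtpn N \<longleftrightarrow>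
     finite (places N) \<and> finite (transitions N) \<and> m0 N \<in> markings N \<and>
     (\<forall>t\<in>transitions N. \<forall>m\<in>markings N. Is N t m \<in> rat_intervals) \<and>
     (\<forall>t\<in>transitions N. \<forall>m\<in>markings N. \<forall>\<theta>\<ge>0. Id N t m \<theta> \<in> real_intervals)"

definition weak_dtpn :: "('p, 't) dtpn \<Rightarrow> bool" where
  "weak_dtpn N \<longleftrightarrow> is_dtpn N \<and>
     (\<forall>t\<in>transitions N. \<forall>m\<in>markings N. \<forall>\<theta>\<ge>0. Id N t m \<theta> = {\<theta>..\<theta>})"

definition time_petri_net :: "('p, 't) dtpn \<Rightarrow> bool" where
  "time_petri_net N \<longleftrightarrow> weak_dtpn N \<and>
     (\<forall>t\<in>transitions N. \<forall>m\<in>markings N. \<forall>m'\<in>markings N. Is N t m = Is N t m')"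

definition enabled :: "('p, 't) dtpn \<Rightarrow> ('p \<Rightarrow> nat) \<Rightarrow> 't set" where
  "enabled N m = {t \<in> transitions N. \<forall>p\<in>places N. Pre N t p \<le> m p}"

definition pers :: "('p, 't) dtpn \<Rightarrow> ('p \<Rightarrow> nat) \<Rightarrow> 't \<Rightarrow> 't set" where
  "pers N m t = {k \<in> enabled N m - {t}. \<forall>p\<in>places N. Pre N k p \<le> m p - Pre N t p}"

definition fire :: "('p, 't) dtpn \<Rightarrow> ('p \<Rightarrow> nat) \<Rightarrow> 't \<Rightarrow> ('p \<Rightarrow> nat)" where
  "fire N m t = (\<lambda>p\<in>places N. m p - Pre N t p + Post N t p)"

type_synonym ('p, 't) state = "('p \<Rightarrow> nat) \<times> ('t \<Rightarrow> real)"

definition net_states :: "('p, 't) dtpn \<Rightarrow> ('p, 't) state set" where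
  "net_states N = {(m, \<phi>). m \<in> markings N \<and> \<phi> \<in> enabled N m \<rightarrow>\<^sub>E {0..}}"

definition net_init :: "('p, 't) dtpn \<Rightarrow> ('p, 't) state set" where
  "net_init N = {(m, \<phi>) \<in> net_states N. m = m0 N \<and> (\<forall>t\<in>enabled N m. \<phi> t \<in> Is N t m)}"

definition discrete_step ::
  "('p, 't) dtpn \<Rightarrow> ('p, 't) state \<Rightarrow> 't \<Rightarrow> ('p, 't) state \<Rightarrow> bool" where
  "discrete_step N s t s' \<longleftrightarrow>
     s \<in> net_states N \<and> s' \<in> net_states N \<and>
     (case (s, s') of ((m, \<phi>), (m', \<phi>')) \<Rightarrow>
        t \<in> enabled N m \<and> \<phi> t = 0 \<and> m' = fire N m t \<and>
        (\<forall>k\<in>pers N m t. \<phi>' k \<in> Id N k m' (\<phi> k)) \<and>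
        (\<forall>k\<in>enabled N m' - pers N m t. \<phi>' k \<in> Is N k m'))"

definition delay_step ::
  "('p, 't) dtpn \<Rightarrow> ('p, 't) state \<Rightarrow> real \<Rightarrow> ('p, 't) state \<Rightarrow> bool" where
  "delay_step N s \<theta> s' \<longleftrightarrow>
     s \<in> net_states N \<and>
     (case s of (m, \<phi>) \<Rightarrow>
        0 \<le> \<theta> \<and> (\<forall>k\<in>enabled N m. \<theta> \<le> \<phi> k) \<and> s' = (m, \<lambda>k\<in>enabled N m. \<phi> k - \<theta>))"

text \<open>The state graph of a net whose transitions are labelled by \<open>lab\<close>, where \<open>None\<close> is the
  silent label. Labelling by \<open>Some\<close> gives the plain state graph.\<close>

definition state_graph ::
  "('p, 't) dtpn \<Rightarrow> ('t \<Rightarrow> 'a option) \<Rightarrow> (('p, 't) state, 'a) tts" where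
  "state_graph N lab =
     \<lparr>states = net_states N, init = net_init N,
      step = (\<lambda>s \<alpha> s'. case \<alpha> of
          Tau \<Rightarrow> \<exists>t. discrete_step N s t s' \<and> lab t = None
        | Act a \<Rightarrow> \<exists>t. discrete_step N s t s' \<and> lab t = Some a
        | Delay \<theta> \<Rightarrow> delay_step N s \<theta> s')\<rparr>"

definition reachable_markings :: "('p, 't) dtpn \<Rightarrow> ('p \<Rightarrow> nat) set" where
  "reachable_markings N = fst ` reachable (state_graph N Some)"

end

theory Submission
  imports Defs
begin

text \<open>
  Each transition \<open>k\<close> of \<open>N\<close> is split into a silent clock \<open>Clock k q\<close> for every reachable marking
  \<open>q\<close> at which \<open>k\<close> may become enabled, with static interval \<open>Is N k q\<close>, and into urgent visible
  copies with interval \<open>{0}\<close>. A control place \<open>Cur m\<close> holds the current marking of \<open>N\<close>, and the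
  place \<open>Status k (Some q)\<close> says that the clock of \<open>k\<close> has been running since \<open>q\<close>; when that
  clock expires it moves its token to \<open>Status k None\<close>. A visible copy \<open>Visible t m \<rho>\<close> moves the
  control token from \<open>m\<close> to \<open>fire N m t\<close>, removes the status tokens \<open>\<rho>\<close> of the non-persistent
  transitions and starts the clocks of the newly enabled ones in a single firing. The status tokens
  of persistent transitions are not touched, so their clocks keep running. An expired clock
  corresponds to a date equal to zero in \<open>N\<close>, which blocks time just as the urgent visible copy
  does; hence silent firings are matched by doing nothing in \<open>N\<close>.
\<close>

section \<open>Isomorphic timed transition systems\<close>

text \<open>The record \<open>tts\<close> does not tie its steps to its set of states. The
  confinement matters because the bijection in the next lemma is controlled on states only.\<close>

definition steps_in_states :: "('s, 'a) tts \<Rightarrow> bool" where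
  "steps_in_states A \<longleftrightarrow>
     init A \<subseteq> states A \<and> (\<forall>s \<alpha> s'. step A s \<alpha> s' \<longrightarrow> s \<in> states A \<and> s' \<in> states A)"

text \<open>The new relation is the old bisimulation composed with the inverse of \<open>g\<close>.
  Silent paths of \<open>B\<close> that start at \<open>g c\<close> never leave
  \<open>states B\<close>, so they lift along \<open>g\<close> step by step. This serves to pass
  from the unfolded net to a copy of it whose names are natural numbers.\<close>

lemma weakly_timed_bisimilar_iso:
  assumes bis: "weakly_timed_bisimilar A B"
    and B: "steps_in_states B" and C: "steps_in_states C"
    and g: "bij_betw g (states C) (states B)"
    and ini: "\<And>s. s \<in> states C \<Longrightarrow> g s \<in> init B \<longleftrightarrow> s \<in> init C"
    and stp: "\<And>s s' \<alpha>. s \<in> states C \<Longrightarrow> s' \<in> states C \<Longrightarrow>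
               step B (g s) \<alpha> (g s') \<longleftrightarrow> step C s \<alpha> s'"
  shows "weakly_timed_bisimilar A C"
proof -
  obtain R where R: "R \<subseteq> states A \<times> states B" "weak_timed_simulation A B R"
    "weak_timed_simulation B A (R\<inverse>)"
    "\<forall>s1\<in>init A. \<exists>s2\<in>init B. (s1, s2) \<in> R" "\<forall>s2\<in>init B. \<exists>s1\<in>init A. (s1, s2) \<in> R"
    using bis unfolding weakly_timed_bisimilar_def by blast
  define R' where "R' = {(a, c). c \<in> states C \<and> (a, g c) \<in> R}"
  have img: "\<exists>c\<in>states C. b = g c" if "b \<in> states B" for b
    using that g by (auto simp: bij_betw_def)
  have gB: "g c \<in> states B" if "c \<in> states C" for c
    using that g by (auto simp: bij_betw_def)
  have taus: "\<exists>c'\<in>states C. b = g c' \<and> (\<lambda>u v. step C u Tau v)\<^sup>*\<^sup>* c c'"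
    if "(\<lambda>u v. step B u Tau v)\<^sup>*\<^sup>* (g c) b" "c \<in> states C" for c b
    using that(1)
  proof (induction rule: rtranclp_induct)
    case base
    then show ?case using that(2) by blast
  next
    case (step y z)
    then obtain c' where c': "c' \<in> states C" "y = g c'" "(\<lambda>u v. step C u Tau v)\<^sup>*\<^sup>* c c'" by blast
    have "z \<in> states B" using step(2) B unfolding steps_in_states_def by blast
    then obtain c'' where "c'' \<in> states C" "z = g c''" using img by blast
    moreover from this have "step C c' Tau c''" using step(2) c' stp by blast
    with c'(3) have "(\<lambda>u v. step C u Tau v)\<^sup>*\<^sup>* c c''" by (rule rtranclp.rtrancl_into_rtrancl)
    ultimately show ?case by blast
  qed
  have wst: "wstep C c \<alpha> c'" if w: "wstep B (g c) \<alpha> (g c')" and c: "c \<in> states C" "c' \<in> states C"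
    for c \<alpha> c'
  proof (cases "\<alpha> = Tau")
    case True
    then have "(\<lambda>u v. step B u Tau v)\<^sup>*\<^sup>* (g c) (g c')" using w by (simp add: wstep_def)
    \<comment> \<open>The lifted path ends at some \<open>d\<close> with the same image as
      \<open>c'\<close>; injectivity of \<open>g\<close> identifies the two.\<close>
    then obtain d where "d \<in> states C" "g c' = g d" "(\<lambda>u v. step C u Tau v)\<^sup>*\<^sup>* c d"
      using taus c by blast
    then show ?thesis using True c g by (auto simp: wstep_def bij_betw_def inj_on_def)
  next
    case False
    then obtain u where "(\<lambda>u v. step B u Tau v)\<^sup>*\<^sup>* (g c) u" "step B u \<alpha> (g c')"
      using w by (auto simp: wstep_def)
    moreover then obtain d where "d \<in> states C" "u = g d" "(\<lambda>u v. step C u Tau v)\<^sup>*\<^sup>* c d"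
      using taus c by blast
    ultimately show ?thesis using False stp c unfolding wstep_def by auto
  qed
  have "weak_timed_simulation A C R'"
    unfolding weak_timed_simulation_def
  proof (intro allI impI)
    fix a c \<alpha> a' assume "(a, c) \<in> R'" "step A a \<alpha> a'"
    then obtain b' where b': "wstep B (g c) \<alpha> b'" "(a', b') \<in> R" and c: "c \<in> states C"
      using R(2) unfolding weak_timed_simulation_def R'_def by blast
    then obtain c' where "c' \<in> states C" "b' = g c'" using img R(1) by blast
    then show "\<exists>c'. wstep C c \<alpha> c' \<and> (a', c') \<in> R'" using b' c wst unfolding R'_def by blast
  qed
  moreover have "weak_timed_simulation C A (R'\<inverse>)"
    unfolding weak_timed_simulation_def
  proof (intro allI impI)
    fix c a \<alpha> c' assume ca: "(c, a) \<in> R'\<inverse>" "step C c \<alpha> c'"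
    then have "c \<in> states C" "c' \<in> states C" "(g c, a) \<in> R\<inverse>"
      using C unfolding steps_in_states_def R'_def by auto
    moreover from this have "step B (g c) \<alpha> (g c')" using ca(2) stp by blast
    ultimately show "\<exists>a'. wstep A a \<alpha> a' \<and> (c', a') \<in> R'\<inverse>"
      using R(3) unfolding weak_timed_simulation_def R'_def by blast
  qed
  moreover have "R' \<subseteq> states A \<times> states C" using R(1) unfolding R'_def by blast
  moreover have "\<forall>a\<in>init A. \<exists>c\<in>init C. (a, c) \<in> R'"
  proof
    fix a assume "a \<in> init A"
    then obtain b where "b \<in> init B" "(a, b) \<in> R" using R(4) by blast
    moreover from this obtain c where "c \<in> states C" "b = g c"
      using B img unfolding steps_in_states_def by blast
    ultimately show "\<exists>c\<in>init C. (a, c) \<in> R'" using ini unfolding R'_def by blast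
  qed
  moreover have "\<forall>c\<in>init C. \<exists>a\<in>init A. (a, c) \<in> R'"
    using C R(5) ini unfolding R'_def steps_in_states_def by blast
  ultimately show ?thesis unfolding weakly_timed_bisimilar_def by blast
qed

section \<open>General facts on state graphs, reachability and persistence\<close>

lemma step_wstep: "step A s \<alpha> s' \<Longrightarrow> wstep A s \<alpha> s'"
  by (auto simp: wstep_def)

lemma delay_step_net_states: "delay_step N s \<theta> s' \<Longrightarrow> s' \<in> net_states N"
  by (auto simp: delay_step_def net_states_def split: prod.splits)

lemma steps_in_states_state_graph: "steps_in_states (state_graph N lab)"
proof -
  have "s \<in> net_states N \<and> s' \<in> net_states N" if "step (state_graph N lab) s \<alpha> s'" for s \<alpha> s'
    using that delay_step_net_states[of N s _ s']
    by (cases \<alpha>) (auto simp: state_graph_def discrete_step_def delay_step_def)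
  moreover have "net_init N \<subseteq> net_states N" by (auto simp: net_init_def)
  ultimately show ?thesis by (simp add: steps_in_states_def state_graph_def)
qed

lemma singleton_real_intervals: "0 \<le> \<theta> \<Longrightarrow> {\<theta>} \<in> real_intervals"
  unfolding real_intervals_def by (rule UnI1) (auto intro!: exI[of _ \<theta>])

lemma reachable_step:
  "s \<in> reachable A \<Longrightarrow> step A s \<alpha> s' \<Longrightarrow> s' \<in> reachable A"
  unfolding reachable_def by (auto intro: rtranclp.rtrancl_into_rtrancl)

lemma reachable_states:
  assumes "steps_in_states A" "s \<in> reachable A"
  shows "s \<in> states A"
proof -
  obtain s0 where "s0 \<in> init A" "(\<lambda>u v. \<exists>\<alpha>. step A u \<alpha> v)\<^sup>*\<^sup>* s0 s"
    using assms(2) by (auto simp: reachable_def)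
  then show ?thesis using assms(1) by (auto simp: steps_in_states_def elim: rtranclp.cases)
qed

lemma net_init_reachable: "s \<in> net_init N \<Longrightarrow> s \<in> reachable (state_graph N Some)"
  by (auto simp: reachable_def state_graph_def)

lemma reachable_net_states: "s \<in> reachable (state_graph N Some) \<Longrightarrow> s \<in> net_states N"
  using reachable_states[OF steps_in_states_state_graph, of s N Some] by (simp add: state_graph_def)

lemma enabled_transitions: "t \<in> enabled N m \<Longrightarrow> t \<in> transitions N"
  by (simp add: enabled_def)

lemma discrete_step_transitions: "discrete_step X s t s' \<Longrightarrow> t \<in> transitions X"
  by (auto simp: discrete_step_def enabled_def split: prod.splits)

lemma pers_enabled: "pers N m t \<subseteq> enabled N m"
  by (auto simp: pers_def)

text \<open>A persistent transition is enabled already after the tokens of \<open>t\<close> are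
  removed, and adding \<open>Post N t\<close> cannot disable it. Hence persistent and newly started
  transitions partition the transitions enabled after firing.\<close>

lemma pers_enabled_fire: "pers N m t \<subseteq> enabled N (fire N m t)"
  by (auto simp: pers_def enabled_def fire_def intro: trans_le_add1)

lemma not_pers_self: "t \<notin> pers N m t"
  by (simp add: pers_def)

section \<open>Renaming the places and transitions of a net\<close>

text \<open>Markings are moved against the renaming. The pullback along \<open>e\<close> is a
  marking of \<open>N\<close> whatever function it is applied to, so the interval functions of the
  renamed net need no side condition.\<close>

definition pull_marking :: "('p, 't) dtpn \<Rightarrow> ('p \<Rightarrow> 'q) \<Rightarrow> ('q \<Rightarrow> nat) \<Rightarrow> 'p \<Rightarrow> nat" where
  "pull_marking N e m = (\<lambda>p\<in>places N. m (e p))"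

definition rename_net ::
  "('p, 't) dtpn \<Rightarrow> ('p \<Rightarrow> 'q) \<Rightarrow> ('t \<Rightarrow> 'u) \<Rightarrow> ('q, 'u) dtpn" where
  "rename_net N e f =
     \<lparr>places = e ` places N, transitions = f ` transitions N,
      Pre = (\<lambda>u q. Pre N (inv_into (transitions N) f u) (inv_into (places N) e q)),
      Post = (\<lambda>u q. Post N (inv_into (transitions N) f u) (inv_into (places N) e q)),
      m0 = (\<lambda>q\<in>e ` places N. m0 N (inv_into (places N) e q)),
      Is = (\<lambda>u m. Is N (inv_into (transitions N) f u) (pull_marking N e m)),
      Id = (\<lambda>u m. Id N (inv_into (transitions N) f u) (pull_marking N e m))\<rparr>"

locale renaming =
  fixes N :: "('p, 't) dtpn" and e :: "'p \<Rightarrow> 'q" and f :: "'t \<Rightarrow> 'u"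
  assumes inj_e: "inj_on e (places N)" and inj_f: "inj_on f (transitions N)"
begin

abbreviation "N' \<equiv> rename_net N e f"
abbreviation "pull \<equiv> pull_marking N e"

lemma rename_net_sel [simp]:
  "places N' = e ` places N" "transitions N' = f ` transitions N"
  "t \<in> transitions N \<Longrightarrow> p \<in> places N \<Longrightarrow> Pre N' (f t) (e p) = Pre N t p"
  "t \<in> transitions N \<Longrightarrow> p \<in> places N \<Longrightarrow> Post N' (f t) (e p) = Post N t p"
  "p \<in> places N \<Longrightarrow> m0 N' (e p) = m0 N p"
  "t \<in> transitions N \<Longrightarrow> Is N' (f t) m = Is N t (pull m)"
  "t \<in> transitions N \<Longrightarrow> Id N' (f t) m = Id N t (pull m)"
  by (auto simp: rename_net_def inj_e inj_f)

lemma pull_apply [simp]: "p \<in> places N \<Longrightarrow> pull m p = m (e p)"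
  by (simp add: pull_marking_def)

lemma pull_markings [simp]: "pull m \<in> markings N"
  by (simp add: pull_marking_def markings_def)

lemma m0_renamed: "m0 N' \<in> markings N'"
  by (auto simp: rename_net_def markings_def)

lemma pull_m0: "m0 N \<in> markings N \<Longrightarrow> pull (m0 N') = m0 N"
  by (auto simp: pull_marking_def markings_def fun_eq_iff PiE_def extensional_def)

lemma enabled_renamed: "enabled N' m = f ` enabled N (pull m)"
  by (auto simp: enabled_def)

lemma enabled_renamed_iff: "t \<in> transitions N \<Longrightarrow> f t \<in> enabled N' m \<longleftrightarrow> t \<in> enabled N (pull m)"
  by (auto simp: enabled_def)

lemma f_eq_iff: "t \<in> transitions N \<Longrightarrow> k \<in> transitions N \<Longrightarrow> f t = f k \<longleftrightarrow> t = k"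
  using inj_f by (auto simp: inj_on_def)

lemma pull_fire: "t \<in> transitions N \<Longrightarrow> pull (fire N' m (f t)) = fire N (pull m) t"
  by (auto simp: pull_marking_def fire_def fun_eq_iff)

text \<open>Markings are extensional, so a marking of \<open>N'\<close> is determined by its values
  on the image of \<open>e\<close>, and these are what \<open>pull\<close> records.\<close>

lemma pull_inj:
  assumes "m \<in> markings N'" "m' \<in> markings N'" "pull m = pull m'"
  shows "m = m'"
proof (rule PiE_ext)
  show "m \<in> e ` places N \<rightarrow>\<^sub>E UNIV" "m' \<in> e ` places N \<rightarrow>\<^sub>E UNIV"
    using assms(1,2) by (simp_all add: markings_def)
  fix q assume "q \<in> e ` places N"
  then obtain p where "p \<in> places N" "q = e p" by blast
  then show "m q = m' q" using pull_apply[of p m] pull_apply[of p m'] assms(3) by simp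
qed

definition pull_state :: "('q, 'u) state \<Rightarrow> ('p, 't) state" where
  "pull_state s = (pull (fst s), \<lambda>t\<in>enabled N (pull (fst s)). snd s (f t))"

lemma pull_state_net_states: "s \<in> net_states N' \<Longrightarrow> pull_state s \<in> net_states N"
  by (auto simp: pull_state_def net_states_def enabled_renamed)

lemma pull_state_inj:
  assumes "s \<in> net_states N'" "s' \<in> net_states N'" "pull_state s = pull_state s'"
  shows "s = s'"
proof -
  obtain m \<phi> m' \<phi>' where s: "s = (m, \<phi>)" "s' = (m', \<phi>')" by (metis surj_pair)
  have m: "m' = m" using assms pull_inj[of m m'] by (auto simp: s pull_state_def net_states_def)
  have "\<phi> = \<phi>'"
  proof (rule PiE_ext)
    show "\<phi> \<in> f ` enabled N (pull m) \<rightarrow>\<^sub>E {0..}" "\<phi>' \<in> f ` enabled N (pull m) \<rightarrow>\<^sub>E {0..}"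
      using assms by (auto simp: s m net_states_def enabled_renamed)
    fix u assume "u \<in> f ` enabled N (pull m)"
    then obtain t where t: "t \<in> enabled N (pull m)" "u = f t" by blast
    have "(\<lambda>t\<in>enabled N (pull m). \<phi> (f t)) = (\<lambda>t\<in>enabled N (pull m). \<phi>' (f t))"
      using assms(3) by (simp add: s m pull_state_def)
    then show "\<phi> u = \<phi>' u" using t by (metis restrict_apply')
  qed
  then show ?thesis by (simp add: s m)
qed

lemma pull_state_surj:
  assumes "s \<in> net_states N"
  shows "\<exists>s'\<in>net_states N'. pull_state s' = s"
proof -
  obtain m \<phi> where s: "s = (m, \<phi>)" by (metis surj_pair)
  \<comment> \<open>The preimages of \<open>m\<close> and \<open>\<phi>\<close> are obtained by
    pushing them forward along the inverses of \<open>e\<close> and \<open>f\<close>, with the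
    default value off the images to stay extensional.\<close>
  define m' where "m' = (\<lambda>q\<in>e ` places N. m (inv_into (places N) e q))"
  have m: "m \<in> places N \<rightarrow>\<^sub>E UNIV" and \<phi>: "\<phi> \<in> enabled N m \<rightarrow>\<^sub>E {0..}"
    using assms by (auto simp: s net_states_def markings_def)
  have pm: "pull m' = m"
    using m by (auto simp: pull_marking_def m'_def fun_eq_iff inj_e PiE_def extensional_def)
  define \<phi>' where "\<phi>' = (\<lambda>u\<in>f ` enabled N m. \<phi> (inv_into (transitions N) f u))"
  have "(m', \<phi>') \<in> net_states N'"
    using \<phi> by (auto simp: net_states_def markings_def m'_def \<phi>'_def enabled_renamed
        pm[unfolded m'_def] inj_f enabled_transitions PiE_def Pi_def)
  moreover have "pull_state (m', \<phi>') = s"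
    using \<phi> by (auto simp: s pull_state_def pm \<phi>'_def fun_eq_iff inj_f enabled_transitions
        PiE_def extensional_def)
  ultimately show ?thesis by blast
qed

lemma bij_pull_state: "bij_betw pull_state (net_states N') (net_states N)"
  unfolding bij_betw_def
proof
  show "inj_on pull_state (net_states N')" using pull_state_inj by (auto intro: inj_onI)
  show "pull_state ` net_states N' = net_states N"
    using pull_state_net_states pull_state_surj by (auto simp: image_iff) metis
qed

lemma net_init_pull_iff:
  assumes "s \<in> net_states N'" "m0 N \<in> markings N"
  shows "pull_state s \<in> net_init N \<longleftrightarrow> s \<in> net_init N'"
proof -
  obtain m \<phi> where s: "s = (m, \<phi>)" by (metis surj_pair)
  have m: "m \<in> markings N'" using assms by (auto simp: s net_states_def)
  have "pull m = m0 N \<longleftrightarrow> m = m0 N'"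
    using pull_m0[OF assms(2)] pull_inj[OF m m0_renamed] by auto
  then show ?thesis
    using assms(1) pull_state_net_states[OF assms(1)]
    by (auto simp: net_init_def s pull_state_def enabled_renamed enabled_transitions)
qed

text \<open>Enabled and persistent transitions of \<open>N'\<close> are the \<open>f\<close>-images
  of those of \<open>N\<close>, so every quantifier in the definition of a step transfers. Equality
  of successor markings transfers by injectivity of \<open>pull\<close>.\<close>

lemma discrete_step_pull_iff:
  assumes s: "s \<in> net_states N'" "s' \<in> net_states N'" and t: "t \<in> transitions N"
  shows "discrete_step N (pull_state s) t (pull_state s') \<longleftrightarrow> discrete_step N' s (f t) s'"
proof -
  obtain m \<phi> m' \<phi>' where ss: "s = (m, \<phi>)" "s' = (m', \<phi>')" by (metis surj_pair)
  have m: "m' \<in> markings N'" using s by (auto simp: ss net_states_def)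
  have "fire N' m (f t) \<in> markings N'" by (simp add: fire_def markings_def)
  then have fire: "pull m' = fire N (pull m) t \<longleftrightarrow> m' = fire N' m (f t)"
    using pull_fire[OF t] pull_inj[OF m] by metis
  have pers: "pers N' m (f t) = f ` pers N (pull m) t"
    using t by (auto simp: pers_def enabled_renamed enabled_transitions f_eq_iff)
  have diff: "enabled N' m' - pers N' m (f t) = f ` (enabled N (pull m') - pers N (pull m) t)"
    using t by (auto simp: pers enabled_renamed f_eq_iff pers_def enabled_transitions)
  show ?thesis
  proof (cases "m' = fire N' m (f t)")
    case True
    have 1: "(\<forall>k\<in>enabled N' m' - pers N' m (f t). \<phi>' k \<in> Is N' k m') \<longleftrightarrow>
        (\<forall>k\<in>enabled N (pull m') - pers N (pull m) t. \<phi>' (f k) \<in> Is N k (pull m'))"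
      unfolding diff ball_simps by (rule ball_cong[OF refl]) (use enabled_transitions[of _ N] in auto)
    have 2: "(\<forall>k\<in>pers N' m (f t). \<phi>' k \<in> Id N' k m' (\<phi> k)) \<longleftrightarrow>
        (\<forall>k\<in>pers N (pull m) t. \<phi>' (f k) \<in> Id N k (pull m') (\<phi> (f k)))"
      unfolding pers ball_simps
      by (rule ball_cong[OF refl]) (use pers_enabled[of N "pull m" t] enabled_transitions[of _ N] in auto)
    \<comment> \<open>Since \<open>m'\<close> is the successor marking, persistent transitions are
      enabled at it, so the restriction inside \<open>pull_state\<close> does not hide their
      dates.\<close>
    have 3: "(\<forall>k\<in>pers N (pull m) t. snd (pull_state s') k \<in> Id N k (pull m') (snd (pull_state s) k)) \<longleftrightarrow>
        (\<forall>k\<in>pers N (pull m) t. \<phi>' (f k) \<in> Id N k (pull m') (\<phi> (f k)))"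
      using pers_enabled[of N "pull m" t] pers_enabled_fire[of N "pull m" t] True fire
      by (intro ball_cong) (auto simp: ss pull_state_def subset_iff)
    show ?thesis
      using s t pull_state_net_states[OF s(1)] pull_state_net_states[OF s(2)] True fire 1 2 3
      by (simp add: discrete_step_def ss pull_state_def enabled_renamed_iff cong: conj_cong)
  next
    case False
    then show ?thesis using fire by (simp add: discrete_step_def ss pull_state_def)
  qed
qed

text \<open>A delay determines its target. It therefore suffices to compare \<open>s'\<close> with
  the state \<open>s''\<close> reached from \<open>s\<close>, using injectivity of
  \<open>pull_state\<close>.\<close>

lemma delay_step_pull_iff:
  assumes s: "s \<in> net_states N'" "s' \<in> net_states N'"
  shows "delay_step N (pull_state s) \<theta> (pull_state s') \<longleftrightarrow> delay_step N' s \<theta> s'"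
proof -
  obtain m \<phi> where ss: "s = (m, \<phi>)" by (metis surj_pair)
  define s'' where "s'' = (m, \<lambda>k\<in>enabled N' m. \<phi> k - \<theta>)"
  have eq: "pull_state s'' =
      (pull m, \<lambda>k\<in>enabled N (pull m). (\<lambda>k\<in>enabled N (pull m). \<phi> (f k)) k - \<theta>)"
    by (auto simp: s''_def pull_state_def enabled_renamed)
  have 1: "pull_state s' = pull_state s'' \<longleftrightarrow> s' = s''"
    if "0 \<le> \<theta>" "\<forall>k\<in>enabled N (pull m). \<theta> \<le> \<phi> (f k)"
  proof -
    have "delay_step N' s \<theta> s''"
      using that s(1) by (auto simp: delay_step_def ss s''_def enabled_renamed)
    then have "s'' \<in> net_states N'" by (rule delay_step_net_states)
    then show ?thesis using pull_state_inj s by blast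
  qed
  show ?thesis
  proof (cases "0 \<le> \<theta> \<and> (\<forall>k\<in>enabled N (pull m). \<theta> \<le> \<phi> (f k))")
    case True
    have "delay_step N (pull_state s) \<theta> (pull_state s') \<longleftrightarrow> pull_state s' = pull_state s''"
      unfolding eq using True pull_state_net_states[OF s(1)]
      by (auto simp: delay_step_def ss pull_state_def)
    also have "\<dots> \<longleftrightarrow> s' = s''" using 1 True by blast
    also have "\<dots> \<longleftrightarrow> delay_step N' s \<theta> s'"
      using True s(1) by (auto simp: delay_step_def ss s''_def enabled_renamed)
    finally show ?thesis .
  next
    case False
    then show ?thesis by (auto simp: delay_step_def ss pull_state_def enabled_renamed)
  qed
qed

lemma weakly_timed_bisimilar_renamed:
  assumes bis: "weakly_timed_bisimilar A (state_graph N lab)" and m0: "m0 N \<in> markings N"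
  shows "weakly_timed_bisimilar A (state_graph N' (lab \<circ> inv_into (transitions N) f))"
    (is "weakly_timed_bisimilar A (state_graph N' ?lab)")
proof (rule weakly_timed_bisimilar_iso[OF bis steps_in_states_state_graph
      steps_in_states_state_graph])
  show "bij_betw pull_state (states (state_graph N' ?lab)) (states (state_graph N lab))"
    using bij_pull_state by (simp add: state_graph_def)
next
  fix s assume "s \<in> states (state_graph N' ?lab)"
  then show "pull_state s \<in> init (state_graph N lab) \<longleftrightarrow> s \<in> init (state_graph N' ?lab)"
    using net_init_pull_iff[OF _ m0] by (simp add: state_graph_def)
next
  fix s s' \<alpha> assume "s \<in> states (state_graph N' ?lab)" "s' \<in> states (state_graph N' ?lab)"
  then have s: "s \<in> net_states N'" "s' \<in> net_states N'" by (simp_all add: state_graph_def)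
  \<comment> \<open>The silent and the visible case of \<open>step\<close> are both instances of
    this, with \<open>a\<close> being \<open>None\<close> or a \<open>Some\<close> label.\<close>
  have d: "(\<exists>t. discrete_step N (pull_state s) t (pull_state s') \<and> lab t = a) \<longleftrightarrow>
      (\<exists>u. discrete_step N' s u s' \<and> ?lab u = a)" for a
  proof
    assume "\<exists>t. discrete_step N (pull_state s) t (pull_state s') \<and> lab t = a"
    then obtain t where t: "discrete_step N (pull_state s) t (pull_state s')" "lab t = a" by blast
    then have "t \<in> transitions N" by (simp add: discrete_step_transitions)
    then show "\<exists>u. discrete_step N' s u s' \<and> ?lab u = a"
      using t discrete_step_pull_iff[OF s] inj_f by (intro exI[of _ "f t"]) auto
  next
    assume "\<exists>u. discrete_step N' s u s' \<and> ?lab u = a"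
    then obtain u where u: "discrete_step N' s u s'" "?lab u = a" by blast
    then obtain t where "t \<in> transitions N" "u = f t"
      using discrete_step_transitions[OF u(1)] by auto
    then show "\<exists>t. discrete_step N (pull_state s) t (pull_state s') \<and> lab t = a"
      using u discrete_step_pull_iff[OF s] inj_f by (intro exI[of _ t]) auto
  qed
  show "step (state_graph N lab) (pull_state s) \<alpha> (pull_state s') \<longleftrightarrow>
      step (state_graph N' ?lab) s \<alpha> s'"
    using d delay_step_pull_iff[OF s] by (cases \<alpha>) (simp_all add: state_graph_def)
qed

lemma time_petri_net_renamed:
  assumes "time_petri_net N"
  shows "time_petri_net N'"
proof -
  have "is_dtpn N'"
    using assms m0_renamed unfolding time_petri_net_def weak_dtpn_def is_dtpn_def
    by (simp add: singleton_real_intervals)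
  then show ?thesis
    using assms unfolding time_petri_net_def weak_dtpn_def by simp
qed

end

section \<open>Unfolding the markings at which clocks are started\<close>

datatype ('p, 't) uplace = Cur "'p \<Rightarrow> nat" | Status 't "('p \<Rightarrow> nat) option"

datatype ('p, 't) utrans =
    Clock 't "'p \<Rightarrow> nat"
  | Visible 't "'p \<Rightarrow> nat" "'t \<Rightarrow> ('p \<Rightarrow> nat) option"

text \<open>A visible copy must know which status place of each non-persistent transition is marked:
  \<open>\<rho>\<close> guesses it, and a wrong guess leaves the copy disabled. The condition
  \<open>\<rho> t = None\<close> makes the copy wait for the clock of \<open>t\<close> to expire.
  The guesses are extensional so that finitely many exist over a finite \<open>M\<close>.\<close>

definition unfolded_net ::
  "('p, 't) dtpn \<Rightarrow> ('p \<Rightarrow> nat) set \<Rightarrow> (('p, 't) uplace, ('p, 't) utrans) dtpn" where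
  "unfolded_net N M =
     \<lparr>places = Cur ` M \<union> {Status k s | k s. k \<in> transitions N \<and> s \<in> insert None (Some ` M)},
      transitions = {Clock k q | k q. k \<in> transitions N \<and> q \<in> M} \<union>
        {Visible t m \<rho> | t m \<rho>. m \<in> M \<and> t \<in> enabled N m \<and> fire N m t \<in> M \<and>
           \<rho> \<in> enabled N m \<rightarrow>\<^sub>E insert None (Some ` M) \<and> \<rho> t = None},
      Pre = (\<lambda>u p. case u of
          Clock k q \<Rightarrow> of_bool (p = Status k (Some q))
        | Visible t m \<rho> \<Rightarrow> (case p of
            Cur m' \<Rightarrow> of_bool (m' = m)
          | Status k s \<Rightarrow> of_bool (k \<in> enabled N m - pers N m t \<and> s = \<rho> k))),
      Post = (\<lambda>u p. case u of
          Clock k q \<Rightarrow> of_bool (p = Status k None)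
        | Visible t m \<rho> \<Rightarrow> (case p of
            Cur m' \<Rightarrow> of_bool (m' = fire N m t)
          | Status k s \<Rightarrow> of_bool (k \<in> enabled N (fire N m t) - pers N m t \<and>
              s = Some (fire N m t)))),
      m0 = (\<lambda>p\<in>Cur ` M \<union> {Status k s | k s. k \<in> transitions N \<and> s \<in> insert None (Some ` M)}.
        case p of
          Cur m \<Rightarrow> of_bool (m = m0 N)
        | Status k s \<Rightarrow> of_bool (k \<in> enabled N (m0 N) \<and> s = Some (m0 N))),
      Is = (\<lambda>u _. case u of Clock k q \<Rightarrow> Is N k q | Visible t m \<rho> \<Rightarrow> {0}),
      Id = (\<lambda>_ _ \<theta>. {\<theta>})\<rparr>"

fun ulabel :: "('p, 't) utrans \<Rightarrow> 't option" where
  "ulabel (Clock k q) = None"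
| "ulabel (Visible t m \<rho>) = Some t"

text \<open>The set \<open>M\<close> may exceed the reachable markings. It bounds the statuses that
  a clock can have and thereby the size of the unfolding.\<close>

locale unfolding_markings =
  fixes N :: "('p, 't) dtpn" and M :: "('p \<Rightarrow> nat) set"
  assumes weak: "weak_dtpn N" and finM: "finite M" and MN: "M \<subseteq> markings N"
    and m0M: "m0 N \<in> M" and reachM: "reachable_markings N \<subseteq> M"
begin

abbreviation "X \<equiv> unfolded_net N M"

lemma places_X [simp]:
  "Cur m \<in> places X \<longleftrightarrow> m \<in> M"
  "Status k s \<in> places X \<longleftrightarrow> k \<in> transitions N \<and> s \<in> insert None (Some ` M)"
  by (auto simp: unfolded_net_def)

lemma ball_places_X:
  "(\<forall>p\<in>places X. P p) \<longleftrightarrow>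
     (\<forall>m\<in>M. P (Cur m)) \<and> (\<forall>k\<in>transitions N. \<forall>s\<in>insert None (Some ` M). P (Status k s))"
  by (force simp: unfolded_net_def)

lemma transitions_X [simp]:
  "Clock k q \<in> transitions X \<longleftrightarrow> k \<in> transitions N \<and> q \<in> M"
  "Visible t m \<rho> \<in> transitions X \<longleftrightarrow> m \<in> M \<and> t \<in> enabled N m \<and> fire N m t \<in> M \<and>
     \<rho> \<in> enabled N m \<rightarrow>\<^sub>E insert None (Some ` M) \<and> \<rho> t = None"
  by (auto simp: unfolded_net_def)

lemma Pre_X [simp]:
  "Pre X (Clock k q) p = of_bool (p = Status k (Some q))"
  "Pre X (Visible t m \<rho>) (Cur m') = of_bool (m' = m)"
  "Pre X (Visible t m \<rho>) (Status k s) = of_bool (k \<in> enabled N m - pers N m t \<and> s = \<rho> k)"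
  by (simp_all add: unfolded_net_def)

lemma Post_X [simp]:
  "Post X (Clock k q) p = of_bool (p = Status k None)"
  "Post X (Visible t m \<rho>) (Cur m') = of_bool (m' = fire N m t)"
  "Post X (Visible t m \<rho>) (Status k s) =
     of_bool (k \<in> enabled N (fire N m t) - pers N m t \<and> s = Some (fire N m t))"
  by (simp_all add: unfolded_net_def)

lemma intervals_X [simp]:
  "Is X (Clock k q) mx = Is N k q" "Is X (Visible t m \<rho>) mx = {0}" "dtpn.Id X u mx \<theta> = {\<theta>}"
  by (simp_all add: unfolded_net_def)

text \<open>This is the shape of marking that the bisimulation maintains; it has at most one token
  per place. The status function \<open>\<sigma>\<close> is total so that it can be updated freely:
  its values outside \<open>enabled N m\<close> do not show in the marking.\<close>

definition config :: "('p \<Rightarrow> nat) \<Rightarrow> ('t \<Rightarrow> ('p \<Rightarrow> nat) option) \<Rightarrow> ('p, 't) uplace \<Rightarrow> nat" where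
  "config m \<sigma> = (\<lambda>p\<in>places X. case p of
      Cur m' \<Rightarrow> of_bool (m' = m) | Status k s \<Rightarrow> of_bool (k \<in> enabled N m \<and> s = \<sigma> k))"

definition admissible :: "('p \<Rightarrow> nat) \<Rightarrow> ('t \<Rightarrow> ('p \<Rightarrow> nat) option) \<Rightarrow> bool" where
  "admissible m \<sigma> \<longleftrightarrow> m \<in> M \<and> (\<forall>k\<in>enabled N m. \<sigma> k \<in> insert None (Some ` M))"

lemma config_markings [simp]: "config m \<sigma> \<in> markings X"
  by (simp add: config_def markings_def)

lemma m0_X: "m0 X = config (m0 N) (\<lambda>_. Some (m0 N))"
  by (simp add: config_def unfolded_net_def)

lemma config_Cur: "m' \<in> M \<Longrightarrow> config m \<sigma> (Cur m') = of_bool (m' = m)"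
  by (simp add: config_def)

lemma config_Status:
  "k \<in> transitions N \<Longrightarrow> s \<in> insert None (Some ` M) \<Longrightarrow>
     config m \<sigma> (Status k s) = of_bool (k \<in> enabled N m \<and> s = \<sigma> k)"
  by (simp add: config_def)

section \<open>Enabling, firing and persistence in the unfolded net\<close>

lemma enabled_Clock:
  assumes "admissible m \<sigma>"
  shows "Clock k q \<in> enabled X (config m \<sigma>) \<longleftrightarrow> k \<in> enabled N m \<and> \<sigma> k = Some q"
proof
  assume a: "Clock k q \<in> enabled X (config m \<sigma>)"
  then have t: "k \<in> transitions N" "q \<in> M" by (auto simp: enabled_def)
  then have "Status k (Some q) \<in> places X" by simp
  then have "Pre X (Clock k q) (Status k (Some q)) \<le> config m \<sigma> (Status k (Some q))"
    using a unfolding enabled_def[of X] by blast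
  then show "k \<in> enabled N m \<and> \<sigma> k = Some q"
    using t by (simp add: config_Status of_bool_def split: if_splits)
next
  assume a: "k \<in> enabled N m \<and> \<sigma> k = Some q"
  then have "k \<in> transitions N" "q \<in> M"
    using assms by (auto simp: admissible_def enabled_transitions)
  then show "Clock k q \<in> enabled X (config m \<sigma>)"
    using a by (auto simp: enabled_def[of X] config_Status)
qed

text \<open>The only control token sits on \<open>Cur m\<close>, which fixes \<open>m'\<close>; the
  only status token of each \<open>k\<close> sits on \<open>Status k (\<sigma> k)\<close>, which
  fixes the guess wherever the copy consumes a status token.\<close>

lemma enabled_Visible:
  assumes "admissible m \<sigma>"
  shows "Visible t m' \<rho> \<in> enabled X (config m \<sigma>) \<longleftrightarrow>
     Visible t m' \<rho> \<in> transitions X \<and> m' = m \<and> (\<forall>k\<in>enabled N m - pers N m t. \<rho> k = \<sigma> k)"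
proof
  assume a: "Visible t m' \<rho> \<in> enabled X (config m \<sigma>)"
  then have tr: "Visible t m' \<rho> \<in> transitions X" by (simp add: enabled_def)
  then have M': "m' \<in> M" by simp
  then have "1 \<le> config m \<sigma> (Cur m')"
    using a by (auto simp: enabled_def[of X] dest!: bspec[of _ _ "Cur m'"])
  then have m': "m' = m" using M' by (simp add: config_Cur of_bool_def split: if_splits)
  have "\<rho> k = \<sigma> k" if k: "k \<in> enabled N m - pers N m t" for k
  proof -
    have 1: "k \<in> transitions N" "\<rho> k \<in> insert None (Some ` M)"
      using k tr m' by (auto simp: enabled_transitions)
    then have "Status k (\<rho> k) \<in> places X" by simp
    then have "Pre X (Visible t m' \<rho>) (Status k (\<rho> k)) \<le> config m \<sigma> (Status k (\<rho> k))"
      using a unfolding enabled_def[of X] by blast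
    then show ?thesis using k 1 m' by (simp add: config_Status of_bool_def split: if_splits)
  qed
  then show "Visible t m' \<rho> \<in> transitions X \<and> m' = m \<and> (\<forall>k\<in>enabled N m - pers N m t. \<rho> k = \<sigma> k)"
    using tr m' by blast
next
  assume "Visible t m' \<rho> \<in> transitions X \<and> m' = m \<and> (\<forall>k\<in>enabled N m - pers N m t. \<rho> k = \<sigma> k)"
  then show "Visible t m' \<rho> \<in> enabled X (config m \<sigma>)"
    unfolding enabled_def[of X] by (auto simp: ball_places_X config_Cur config_Status)
qed

lemma fire_Clock:
  assumes "admissible m \<sigma>" "k \<in> enabled N m" "\<sigma> k = Some q"
  shows "fire X (config m \<sigma>) (Clock k q) = config m (\<sigma>(k := None))"
  unfolding fire_def config_def
  by (rule restrict_ext) (use assms in \<open>auto split: uplace.split\<close>)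

definition restart :: "('p \<Rightarrow> nat) \<Rightarrow> 't \<Rightarrow> ('t \<Rightarrow> ('p \<Rightarrow> nat) option) \<Rightarrow> 't \<Rightarrow> ('p \<Rightarrow> nat) option" where
  "restart m t \<sigma> k = (if k \<in> pers N m t then \<sigma> k else Some (fire N m t))"

lemma admissible_restart:
  "admissible m \<sigma> \<Longrightarrow> fire N m t \<in> M \<Longrightarrow> admissible (fire N m t) (restart m t \<sigma>)"
  using pers_enabled[of N m t] by (auto simp: admissible_def restart_def)

lemma admissible_upd: "admissible m \<sigma> \<Longrightarrow> admissible m (\<sigma>(k := None))"
  by (auto simp: admissible_def)

text \<open>At a status place of a persistent transition nothing is consumed or produced. For any
  other enabled transition the guess is correct, so its old token disappears, and
  \<open>Post\<close> places a fresh one exactly where a clock starts at the new marking.\<close>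

lemma fire_Visible:
  assumes "admissible m \<sigma>" "Visible t m \<rho> \<in> enabled X (config m \<sigma>)"
  shows "fire X (config m \<sigma>) (Visible t m \<rho>) = config (fire N m t) (restart m t \<sigma>)"
proof -
  have \<rho>: "\<rho> k = \<sigma> k" if "k \<in> enabled N m" "k \<notin> pers N m t" for k
    using assms that by (simp add: enabled_Visible)
  show ?thesis
    unfolding fire_def[of X] config_def
  proof (rule restrict_ext)
    fix p assume p: "p \<in> places X"
    show "restrict (case_uplace (\<lambda>m'. of_bool (m' = m)) (\<lambda>k s. of_bool (k \<in> enabled N m \<and> s = \<sigma> k)))
           (places X) p - Pre X (Visible t m \<rho>) p + Post X (Visible t m \<rho>) p =
         (case p of Cur m' \<Rightarrow> of_bool (m' = fire N m t)
          | Status k s \<Rightarrow> of_bool (k \<in> enabled N (fire N m t) \<and> s = restart m t \<sigma> k))"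
    proof (cases p)
      case (Cur m')
      then show ?thesis using p by simp
    next
      case (Status k s)
      then show ?thesis
        using p \<rho>[of k] pers_enabled[of N m t] pers_enabled_fire[of N m t]
        by (cases "k \<in> pers N m t") (auto simp: restart_def)
    qed
  qed
qed

text \<open>Each clock consumes only the status token of its own transition, so clocks never disturb
  one another.\<close>

lemma pers_Clock_Clock:
  assumes "admissible m \<sigma>" "k \<in> enabled N m" "\<sigma> k = Some q"
  shows "Clock j r \<in> pers X (config m \<sigma>) (Clock k q) \<longleftrightarrow> j \<noteq> k \<and> j \<in> enabled N m \<and> \<sigma> j = Some r"
proof (cases "j \<in> enabled N m \<and> \<sigma> j = Some r")
  case True
  then have "j \<in> transitions N" "r \<in> M"
    using assms(1) by (auto simp: admissible_def enabled_transitions)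
  then show ?thesis
    using True assms by (auto simp: pers_def[of X] enabled_Clock config_Status)
next
  case False
  then show ?thesis using assms by (auto simp: pers_def[of X] enabled_Clock)
qed

text \<open>This is where persistence in the unfolding reflects persistence in \<open>N\<close>: a
  visible copy takes exactly the status tokens of the non-persistent transitions, and a running
  clock survives if and only if its token does.\<close>

lemma pers_Visible_Clock:
  assumes "admissible m \<sigma>" "Visible t m \<rho> \<in> enabled X (config m \<sigma>)"
  shows "Clock j r \<in> pers X (config m \<sigma>) (Visible t m \<rho>) \<longleftrightarrow> j \<in> pers N m t \<and> \<sigma> j = Some r"
proof (cases "j \<in> enabled N m \<and> \<sigma> j = Some r")
  case True
  then have "j \<in> transitions N" "r \<in> M"
    using assms(1) by (auto simp: admissible_def enabled_transitions)
  \<comment> \<open>For a non-persistent \<open>j\<close> the enabled copy guesses the actual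
    status, so it consumes the single token on which the clock of \<open>j\<close> depends.\<close>
  moreover have "j \<in> pers N m t \<or> \<rho> j = Some r"
    using assms True by (metis DiffI enabled_Visible)
  ultimately show ?thesis
    using True assms(1) by (auto simp: pers_def[of X] enabled_Clock config_Status ball_places_X)
next
  case False
  then show ?thesis using assms(1) pers_enabled[of N m t] by (auto simp: pers_def[of X] enabled_Clock)
qed

section \<open>Firing dates and steps of the unfolded net\<close>

definition dates ::
  "('p \<Rightarrow> nat) \<Rightarrow> ('t \<Rightarrow> ('p \<Rightarrow> nat) option) \<Rightarrow> ('t \<Rightarrow> real) \<Rightarrow> ('p, 't) utrans \<Rightarrow> real" where
  "dates m \<sigma> \<phi> = (\<lambda>u\<in>enabled X (config m \<sigma>). case u of Clock k q \<Rightarrow> \<phi> k | Visible t m' \<rho> \<Rightarrow> 0)"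

lemma dates_net_states:
  assumes "admissible m \<sigma>" "(m, \<phi>) \<in> net_states N"
  shows "(config m \<sigma>, dates m \<sigma> \<phi>) \<in> net_states X"
  using assms by (auto simp: net_states_def dates_def enabled_Clock PiE_iff split: utrans.split)

text \<open>Dates over \<open>config m \<sigma>\<close> are fixed by the running clocks and by zero
  at the visible copies. The date of an expired transition is not stored; it is known to be
  zero.\<close>

lemma eq_datesI:
  assumes "admissible m \<sigma>" "(config m \<sigma>, \<phi>x) \<in> net_states X"
    and "\<And>k q. k \<in> enabled N m \<Longrightarrow> \<sigma> k = Some q \<Longrightarrow> \<phi>x (Clock k q) = \<phi> k"
    and "\<And>t m' \<rho>. Visible t m' \<rho> \<in> enabled X (config m \<sigma>) \<Longrightarrow> \<phi>x (Visible t m' \<rho>) = 0"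
  shows "\<phi>x = dates m \<sigma> \<phi>"
proof
  fix u
  show "\<phi>x u = dates m \<sigma> \<phi> u"
  proof (cases "u \<in> enabled X (config m \<sigma>)")
    case True
    then show ?thesis
      using assms by (cases u) (auto simp: dates_def enabled_Clock)
  next
    case False
    then show ?thesis
      using assms(2) by (auto simp: dates_def net_states_def PiE_def extensional_def)
  qed
qed

text \<open>Visible copies have date zero after the step whether they persist, keeping a zero, or
  are new, drawing from \<open>{0}\<close>. Persistence thus makes a difference for clocks
  only.\<close>

lemma discrete_step_dates_iff:
  assumes adm: "admissible m \<sigma>" "admissible m' \<sigma>'"
    and st: "(m, \<phi>) \<in> net_states N"
    and u: "u \<in> enabled X (config m \<sigma>)" "fire X (config m \<sigma>) u = config m' \<sigma>'"
  shows "discrete_step X (config m \<sigma>, dates m \<sigma> \<phi>) u (config m' \<sigma>', \<phi>x) \<longleftrightarrow>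
    (config m' \<sigma>', \<phi>x) \<in> net_states X \<and> dates m \<sigma> \<phi> u = 0 \<and>
    (\<forall>t m'' \<rho>. Visible t m'' \<rho> \<in> enabled X (config m' \<sigma>') \<longrightarrow> \<phi>x (Visible t m'' \<rho>) = 0) \<and>
    (\<forall>k q. k \<in> enabled N m' \<longrightarrow> \<sigma>' k = Some q \<longrightarrow>
       (if Clock k q \<in> pers X (config m \<sigma>) u then \<phi>x (Clock k q) = \<phi> k
        else \<phi>x (Clock k q) \<in> Is N k q))" (is "?L \<longleftrightarrow> ?R")
proof -
  let ?P = "pers X (config m \<sigma>) u"
  note sub = pers_enabled[of X "config m \<sigma>" u]
  have sub': "?P \<subseteq> enabled X (config m' \<sigma>')"
    unfolding u(2)[symmetric] by (rule pers_enabled_fire)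
  have "?L \<longleftrightarrow> (config m' \<sigma>', \<phi>x) \<in> net_states X \<and> dates m \<sigma> \<phi> u = 0 \<and>
      (\<forall>v\<in>enabled X (config m' \<sigma>').
         if v \<in> ?P then \<phi>x v = dates m \<sigma> \<phi> v else \<phi>x v \<in> Is X v (config m' \<sigma>'))"
    using u dates_net_states[OF adm(1) st] sub' by (auto simp: discrete_step_def)
  also have "\<dots> \<longleftrightarrow> ?R"
  proof -
    have "(if v \<in> ?P then \<phi>x v = dates m \<sigma> \<phi> v else \<phi>x v \<in> Is X v (config m' \<sigma>')) \<longleftrightarrow>
        (case v of Clock k q \<Rightarrow> (if v \<in> ?P then \<phi>x v = \<phi> k else \<phi>x v \<in> Is N k q)
         | Visible t m'' \<rho> \<Rightarrow> \<phi>x v = 0)" for v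
      using sub by (cases v) (auto simp: dates_def)
    moreover have "(\<forall>v\<in>enabled X (config m' \<sigma>'). F v) \<longleftrightarrow>
        (\<forall>t m'' \<rho>. Visible t m'' \<rho> \<in> enabled X (config m' \<sigma>') \<longrightarrow> F (Visible t m'' \<rho>)) \<and>
        (\<forall>k q. k \<in> enabled N m' \<longrightarrow> \<sigma>' k = Some q \<longrightarrow> F (Clock k q))" for F
      using enabled_Clock[OF adm(2)] by (metis utrans.exhaust)
    ultimately show ?thesis by simp
  qed
  finally show ?thesis .
qed

text \<open>A clock that still runs after the silent firing belongs to another transition and hence
  persists with its date. The firing therefore changes only the status of \<open>k\<close>.\<close>

lemma discrete_step_Clock:
  assumes adm: "admissible m \<sigma>" and st: "(m, \<phi>) \<in> net_states N"
  shows "discrete_step X (config m \<sigma>, dates m \<sigma> \<phi>) (Clock k q) s' \<longleftrightarrow>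
     k \<in> enabled N m \<and> \<sigma> k = Some q \<and> \<phi> k = 0 \<and>
     s' = (config m (\<sigma>(k := None)), dates m (\<sigma>(k := None)) \<phi>)"
proof (cases "k \<in> enabled N m \<and> \<sigma> k = Some q")
  case True
  let ?\<sigma> = "\<sigma>(k := None)"
  have en: "Clock k q \<in> enabled X (config m \<sigma>)" using True adm by (simp add: enabled_Clock)
  have adm': "admissible m ?\<sigma>" using adm by (rule admissible_upd)
  have fire: "fire X (config m \<sigma>) (Clock k q) = config m ?\<sigma>" using True adm by (simp add: fire_Clock)
  have d: "dates m \<sigma> \<phi> (Clock k q) = \<phi> k" using en by (simp add: dates_def)
  note iff = discrete_step_dates_iff[OF adm adm' st en fire]
  show ?thesis
  proof
    assume L: "discrete_step X (config m \<sigma>, dates m \<sigma> \<phi>) (Clock k q) s'"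
    obtain \<phi>x where s': "s' = (config m ?\<sigma>, \<phi>x)"
      using L fire by (cases s') (auto simp: discrete_step_def)
    have R: "(config m ?\<sigma>, \<phi>x) \<in> net_states X" "\<phi> k = 0"
      "\<And>t m'' \<rho>. Visible t m'' \<rho> \<in> enabled X (config m ?\<sigma>) \<Longrightarrow> \<phi>x (Visible t m'' \<rho>) = 0"
      "\<And>j r. j \<in> enabled N m \<Longrightarrow> ?\<sigma> j = Some r \<Longrightarrow>
         Clock j r \<in> pers X (config m \<sigma>) (Clock k q) \<Longrightarrow> \<phi>x (Clock j r) = \<phi> j"
      using L unfolding s' iff d by auto
    have "\<phi>x = dates m ?\<sigma> \<phi>"
    proof (rule eq_datesI[OF adm' R(1) _ R(3)])
      fix j r assume j: "j \<in> enabled N m" "?\<sigma> j = Some r"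
      then have "Clock j r \<in> pers X (config m \<sigma>) (Clock k q)"
        using True adm by (auto simp: pers_Clock_Clock split: if_splits)
      then show "\<phi>x (Clock j r) = \<phi> j" using R(4) j by blast
    qed
    then show "k \<in> enabled N m \<and> \<sigma> k = Some q \<and> \<phi> k = 0 \<and> s' = (config m ?\<sigma>, dates m ?\<sigma> \<phi>)"
      using True R(2) s' by simp
  next
    assume R: "k \<in> enabled N m \<and> \<sigma> k = Some q \<and> \<phi> k = 0 \<and> s' = (config m ?\<sigma>, dates m ?\<sigma> \<phi>)"
    then have s': "s' = (config m ?\<sigma>, dates m ?\<sigma> \<phi>)" by blast
    have clk: "Clock j r \<in> pers X (config m \<sigma>) (Clock k q) \<and> dates m ?\<sigma> \<phi> (Clock j r) = \<phi> j"
      if "j \<in> enabled N m" "?\<sigma> j = Some r" for j r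
    proof -
      have "Clock j r \<in> enabled X (config m ?\<sigma>)" using that adm' by (simp only: enabled_Clock simp_thms)
      moreover have "Clock j r \<in> pers X (config m \<sigma>) (Clock k q)"
        using that True adm by (auto simp: pers_Clock_Clock split: if_splits)
      ultimately show ?thesis by (simp add: dates_def)
    qed
    have vis: "dates m ?\<sigma> \<phi> (Visible t m'' \<rho>) = 0"
      if "Visible t m'' \<rho> \<in> enabled X (config m ?\<sigma>)" for t m'' \<rho>
      using that by (simp add: dates_def)
    show "discrete_step X (config m \<sigma>, dates m \<sigma> \<phi>) (Clock k q) s'"
      unfolding s' iff d using dates_net_states[OF adm' st] R clk vis by presburger
  qed
next
  case False
  then have "Clock k q \<notin> enabled X (config m \<sigma>)" using adm enabled_Clock by blast
  then show ?thesis using False by (auto simp: discrete_step_def split: prod.splits)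
qed

text \<open>Weakness of \<open>N\<close> enters here: dates are non-negative, so the dynamic
  interval of a persistent transition is the singleton of its current date.\<close>

lemma discrete_step_N_iff:
  assumes "(m, \<phi>) \<in> net_states N"
  shows "discrete_step N (m, \<phi>) t (m', \<phi>') \<longleftrightarrow>
    (m', \<phi>') \<in> net_states N \<and> t \<in> enabled N m \<and> \<phi> t = 0 \<and> m' = fire N m t \<and>
    (\<forall>k\<in>pers N m t. \<phi>' k = \<phi> k) \<and> (\<forall>k\<in>enabled N m' - pers N m t. \<phi>' k \<in> Is N k m')"
proof -
  have "dtpn.Id N k m' (\<phi> k) = {\<phi> k}" if "k \<in> pers N m t" "m' \<in> markings N" for k
  proof -
    have "k \<in> enabled N m" using that pers_enabled[of N m t] by blast
    moreover from this have "0 \<le> \<phi> k" using assms by (auto simp: net_states_def)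
    ultimately show ?thesis using weak that(2) by (simp add: weak_dtpn_def enabled_transitions)
  qed
  then show ?thesis using assms by (auto simp: discrete_step_def net_states_def)
qed

lemma Visible_of_discrete_step:
  assumes adm: "admissible m \<sigma>" and st: "(m, \<phi>) \<in> net_states N" and ready: "\<sigma> t = None"
    and L: "discrete_step N (m, \<phi>) t (m', \<phi>')" and m'M: "m' \<in> M"
  shows "\<exists>\<rho>. discrete_step X (config m \<sigma>, dates m \<sigma> \<phi>) (Visible t m \<rho>)
              (config m' (restart m t \<sigma>), dates m' (restart m t \<sigma>) \<phi>')"
proof -
  \<comment> \<open>The copy to fire is the one that guesses every status correctly; it is a legal
    copy because \<open>\<sigma> t = None\<close>.\<close>
  let ?\<rho> = "restrict \<sigma> (enabled N m)" and ?\<sigma> = "restart m t \<sigma>"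
  note N = L[unfolded discrete_step_N_iff[OF st]]
  have m': "m' = fire N m t" using N by blast
  have en: "Visible t m ?\<rho> \<in> enabled X (config m \<sigma>)"
    using adm N ready m'M by (auto simp: enabled_Visible admissible_def)
  have adm': "admissible m' ?\<sigma>" using admissible_restart adm m'M m' by blast
  have fire: "fire X (config m \<sigma>) (Visible t m ?\<rho>) = config m' ?\<sigma>"
    unfolding m' using fire_Visible[OF adm en] .
  have st': "(m', \<phi>') \<in> net_states N" using N by blast
  have "discrete_step X (config m \<sigma>, dates m \<sigma> \<phi>) (Visible t m ?\<rho>) (config m' ?\<sigma>, dates m' ?\<sigma> \<phi>')"
    unfolding discrete_step_dates_iff[OF adm adm' st en fire]
  proof (intro conjI allI impI)
    show "(config m' ?\<sigma>, dates m' ?\<sigma> \<phi>') \<in> net_states X" using dates_net_states[OF adm' st'] .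
    show "dates m \<sigma> \<phi> (Visible t m ?\<rho>) = 0" using en by (simp add: dates_def)
    show "dates m' ?\<sigma> \<phi>' (Visible t' m'' \<rho>) = 0"
      if "Visible t' m'' \<rho> \<in> enabled X (config m' ?\<sigma>)" for t' m'' \<rho>
      using that by (simp add: dates_def)
    fix k q assume k: "k \<in> enabled N m'" "?\<sigma> k = Some q"
    then have "Clock k q \<in> enabled X (config m' ?\<sigma>)" using adm' by (simp only: enabled_Clock simp_thms)
    then have d: "dates m' ?\<sigma> \<phi>' (Clock k q) = \<phi>' k" by (simp add: dates_def)
    show "if Clock k q \<in> pers X (config m \<sigma>) (Visible t m ?\<rho>)
      then dates m' ?\<sigma> \<phi>' (Clock k q) = \<phi> k else dates m' ?\<sigma> \<phi>' (Clock k q) \<in> Is N k q"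
      unfolding d pers_Visible_Clock[OF adm en]
      using N k by (auto simp: restart_def m' split: if_splits)
  qed
  then show ?thesis by blast
qed

text \<open>The enabled copy forces \<open>\<sigma> t = None\<close>, so \<open>zero\<close> gives
  date zero to \<open>t\<close> in \<open>N\<close>. Newly sampled clocks supply the dates of the
  newly started transitions.\<close>

lemma discrete_step_of_Visible:
  assumes adm: "admissible m \<sigma>" and st: "(m, \<phi>) \<in> net_states N"
    and zero: "\<And>k. k \<in> enabled N m \<Longrightarrow> \<sigma> k = None \<Longrightarrow> \<phi> k = 0"
    and L: "discrete_step X (config m \<sigma>, dates m \<sigma> \<phi>) (Visible t m1 \<rho>) s'"
  shows "\<exists>\<phi>'. discrete_step N (m, \<phi>) t (fire N m t, \<phi>') \<and> fire N m t \<in> M \<and>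
           s' = (config (fire N m t) (restart m t \<sigma>), dates (fire N m t) (restart m t \<sigma>) \<phi>')"
proof -
  let ?\<sigma> = "restart m t \<sigma>" and ?m = "fire N m t"
  have "Visible t m1 \<rho> \<in> enabled X (config m \<sigma>)"
    using L by (auto simp: discrete_step_def split: prod.splits)
  then have m1: "m1 = m" and en: "Visible t m \<rho> \<in> enabled X (config m \<sigma>)"
    using enabled_Visible[OF adm] by auto
  have t: "t \<in> enabled N m" and M': "?m \<in> M" and r: "\<sigma> t = None"
    using en not_pers_self[of t N m] unfolding enabled_Visible[OF adm] by auto
  have adm': "admissible ?m ?\<sigma>" using admissible_restart adm M' by blast
  have fire: "fire X (config m \<sigma>) (Visible t m \<rho>) = config ?m ?\<sigma>"
    using fire_Visible[OF adm en] .
  obtain \<phi>x where s': "s' = (config ?m ?\<sigma>, \<phi>x)"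
    using L m1 fire by (cases s') (auto simp: discrete_step_def)
  have R: "(config ?m ?\<sigma>, \<phi>x) \<in> net_states X"
    "\<And>t m'' \<rho>. Visible t m'' \<rho> \<in> enabled X (config ?m ?\<sigma>) \<Longrightarrow> \<phi>x (Visible t m'' \<rho>) = 0"
    and clk: "\<And>k q. k \<in> enabled N ?m \<Longrightarrow> ?\<sigma> k = Some q \<Longrightarrow>
       (if k \<in> pers N m t \<and> \<sigma> k = Some q then \<phi>x (Clock k q) = \<phi> k
        else \<phi>x (Clock k q) \<in> Is N k q)"
    using L unfolding s' m1 discrete_step_dates_iff[OF adm adm' st en fire]
      pers_Visible_Clock[OF adm en] by blast+
  \<comment> \<open>Persistent transitions take their date from \<open>\<phi>\<close>, not from
    \<open>\<phi>x\<close>: an expired one has no enabled clock to read it from.\<close>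
  define \<phi>' where
    "\<phi>' = (\<lambda>k\<in>enabled N ?m. if k \<in> pers N m t then \<phi> k else \<phi>x (Clock k ?m))"
  have new: "\<phi>x (Clock k ?m) \<in> Is N k ?m \<and> 0 \<le> \<phi>x (Clock k ?m)"
    if k: "k \<in> enabled N ?m" "k \<notin> pers N m t" for k
  proof
    have \<sigma>k: "?\<sigma> k = Some ?m" using k by (simp add: restart_def)
    then show "\<phi>x (Clock k ?m) \<in> Is N k ?m" using clk[OF k(1)] k by auto
    have "Clock k ?m \<in> enabled X (config ?m ?\<sigma>)" using k \<sigma>k by (simp add: enabled_Clock[OF adm'])
    then show "0 \<le> \<phi>x (Clock k ?m)" using R(1) by (auto simp: net_states_def)
  qed
  have old: "0 \<le> \<phi> k" if "k \<in> pers N m t" for k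
    using that pers_enabled[of N m t] st by (auto simp: net_states_def)
  have "(?m, \<phi>') \<in> net_states N"
    using new old M' MN by (auto simp: net_states_def \<phi>'_def)
  then have "discrete_step N (m, \<phi>) t (?m, \<phi>')"
    unfolding discrete_step_N_iff[OF st]
    using t zero[OF t r] new pers_enabled_fire[of N m t] by (auto simp: \<phi>'_def)
  moreover have "\<phi>x = dates ?m ?\<sigma> \<phi>'"
  proof (rule eq_datesI[OF adm' R(1) _ R(2)])
    fix k q assume k: "k \<in> enabled N ?m" "?\<sigma> k = Some q"
    then show "\<phi>x (Clock k q) = \<phi>' k"
      using clk[OF k] by (auto simp: \<phi>'_def restart_def split: if_splits)
  qed
  ultimately show ?thesis using s' M' by blast
qed

text \<open>A running clock bounds the delay by the date of its transition. An expired transition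
  has date zero in \<open>N\<close> and an urgent visible copy in \<open>X\<close>, so it blocks
  time in both nets.\<close>

lemma delay_step_dates_iff:
  assumes adm: "admissible m \<sigma>" and st: "(m, \<phi>) \<in> net_states N"
    and zero: "\<And>k. k \<in> enabled N m \<Longrightarrow> \<sigma> k = None \<Longrightarrow> \<phi> k = 0"
    and closed: "\<And>t. t \<in> enabled N m \<Longrightarrow> \<phi> t = 0 \<Longrightarrow> fire N m t \<in> M"
  shows "delay_step X (config m \<sigma>, dates m \<sigma> \<phi>) \<theta> s' \<longleftrightarrow>
    (\<exists>\<phi>'. delay_step N (m, \<phi>) \<theta> (m, \<phi>') \<and> s' = (config m \<sigma>, dates m \<sigma> \<phi>'))"
proof -
  let ?E = "enabled X (config m \<sigma>)" and ?\<phi> = "\<lambda>k\<in>enabled N m. \<phi> k - \<theta>"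
  have wait: "(\<forall>u\<in>?E. \<theta> \<le> dates m \<sigma> \<phi> u) \<longleftrightarrow> (\<forall>k\<in>enabled N m. \<theta> \<le> \<phi> k)" (is "?L \<longleftrightarrow> ?R")
  proof
    assume L: ?L
    show ?R
    proof
      fix k assume k: "k \<in> enabled N m"
      show "\<theta> \<le> \<phi> k"
      proof (cases "\<sigma> k")
        case None
        \<comment> \<open>The assumption \<open>closed\<close> puts the successor marking into
          \<open>M\<close>, so the urgent copy exists.\<close>
        have "Visible k m (restrict \<sigma> (enabled N m)) \<in> ?E"
          using adm k None closed[OF k zero[OF k None]]
          by (auto simp: enabled_Visible admissible_def)
        then show ?thesis using L zero[OF k None] by (auto simp: dates_def)
      next
        case (Some q)
        then have "Clock k q \<in> ?E" using adm k by (simp add: enabled_Clock)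
        then show ?thesis using L by (auto simp: dates_def)
      qed
    qed
  next
    assume R: ?R
    show ?L
    proof
      fix u assume u: "u \<in> ?E"
      show "\<theta> \<le> dates m \<sigma> \<phi> u"
      proof (cases u)
        case (Clock k q)
        then show ?thesis using u R adm by (auto simp: dates_def enabled_Clock)
      next
        case (Visible t m1 \<rho>)
        then have "t \<in> enabled N m" "\<sigma> t = None"
          using u not_pers_self[of t N m] by (auto simp: enabled_Visible[OF adm])
        then show ?thesis using u R zero[of t] Visible by (auto simp: dates_def)
      qed
    qed
  qed
  have shift: "(\<lambda>u\<in>?E. dates m \<sigma> \<phi> u - \<theta>) = dates m \<sigma> ?\<phi>"
    if "0 \<le> \<theta>" "\<forall>k\<in>enabled N m. \<theta> \<le> \<phi> k"
    unfolding dates_def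
  proof (rule restrict_ext)
    fix u assume u: "u \<in> ?E"
    show "restrict (case_utrans (\<lambda>k q. \<phi> k) (\<lambda>t m' \<rho>. 0)) ?E u - \<theta> =
        (case u of Clock k q \<Rightarrow> ?\<phi> k | Visible t m' \<rho> \<Rightarrow> 0)"
    proof (cases u)
      case (Clock k q)
      then show ?thesis using u adm by (simp add: enabled_Clock)
    next
      case (Visible t m1 \<rho>)
      then have "t \<in> enabled N m" "\<sigma> t = None"
        using u not_pers_self[of t N m] by (auto simp: enabled_Visible[OF adm])
      \<comment> \<open>An enabled copy means an expired transition with date zero, so only the zero
        delay is possible and the date of the copy stays zero.\<close>
      then have "\<theta> = 0" using that zero[of t] by force
      then show ?thesis using u Visible by simp
    qed
  qed
  show ?thesis
    using dates_net_states[OF adm st] st wait shift by (auto simp: delay_step_def)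
qed

text \<open>One state of \<open>N\<close> has several partners, one for each way of having expired
  some of the clocks whose date is zero. Reachability keeps all successor markings inside
  \<open>M\<close>.\<close>

definition unfolding_rel :: "(('p, 't) state \<times> (('p, 't) uplace, ('p, 't) utrans) state) set" where
  "unfolding_rel = {((m, \<phi>), (config m \<sigma>, dates m \<sigma> \<phi>)) | m \<phi> \<sigma>.
     (m, \<phi>) \<in> reachable (state_graph N Some) \<and> admissible m \<sigma> \<and>
     (\<forall>k\<in>enabled N m. \<sigma> k = None \<longrightarrow> \<phi> k = 0)}"

section \<open>The two simulations\<close>

lemma reachable_discrete_step:
  assumes "s \<in> reachable (state_graph N Some)" "discrete_step N s t s'"
  shows "s' \<in> reachable (state_graph N Some)"
  using reachable_step[OF assms(1), of "Act t" s'] assms(2) by (simp add: state_graph_def)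

lemma reachable_marking: "(m, \<phi>) \<in> reachable (state_graph N Some) \<Longrightarrow> m \<in> M"
  using reachM by (force simp: reachable_markings_def)

text \<open>A due transition leads to a marking in \<open>M\<close> because an actual successor
  state exists: persistent dates are kept, and rational intervals are non-empty, so the remaining
  dates can be chosen.\<close>

lemma closed_fire:
  assumes "(m, \<phi>) \<in> reachable (state_graph N Some)" "t \<in> enabled N m" "\<phi> t = 0"
  shows "fire N m t \<in> M"
proof -
  have st: "(m, \<phi>) \<in> net_states N" using assms(1) by (rule reachable_net_states)
  have mk: "fire N m t \<in> markings N" by (simp add: fire_def markings_def)
  have ne: "\<exists>x\<ge>0. x \<in> Is N k (fire N m t)" if "k \<in> enabled N (fire N m t)" for k
  proof -
    have "Is N k (fire N m t) \<in> rat_intervals"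
      using weak mk that by (simp add: weak_dtpn_def is_dtpn_def enabled_transitions)
    then show ?thesis by (auto simp: rat_intervals_def)
  qed
  define \<phi>' where "\<phi>' = (\<lambda>k\<in>enabled N (fire N m t).
    if k \<in> pers N m t then \<phi> k else SOME x. 0 \<le> x \<and> x \<in> Is N k (fire N m t))"
  have new: "0 \<le> \<phi>' k \<and> \<phi>' k \<in> Is N k (fire N m t)"
    if "k \<in> enabled N (fire N m t)" "k \<notin> pers N m t" for k
    using someI_ex[OF ne[OF that(1)]] that by (simp add: \<phi>'_def)
  have old: "\<phi>' k = \<phi> k" "0 \<le> \<phi> k" if "k \<in> pers N m t" for k
    using that pers_enabled[of N m t] pers_enabled_fire[of N m t] st
    by (auto simp: \<phi>'_def net_states_def)
  have "0 \<le> \<phi>' k" if "k \<in> enabled N (fire N m t)" for k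
    using new[OF that] old[of k] by (cases "k \<in> pers N m t") auto
  then have "\<phi>' \<in> enabled N (fire N m t) \<rightarrow>\<^sub>E {0..}"
    by (simp add: PiE_iff) (simp add: \<phi>'_def)
  then have "discrete_step N (m, \<phi>) t (fire N m t, \<phi>')"
    unfolding discrete_step_N_iff[OF st] using assms mk new old by (auto simp: net_states_def)
  then show ?thesis using reachable_discrete_step[OF assms(1)] reachable_marking by blast
qed

lemma unfolding_relI:
  "(m, \<phi>) \<in> reachable (state_graph N Some) \<Longrightarrow> admissible m \<sigma> \<Longrightarrow>
   (\<And>k. k \<in> enabled N m \<Longrightarrow> \<sigma> k = None \<Longrightarrow> \<phi> k = 0) \<Longrightarrow>
   ((m, \<phi>), (config m \<sigma>, dates m \<sigma> \<phi>)) \<in> unfolding_rel"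
  unfolding unfolding_rel_def by blast

text \<open>After a visible firing only persistent transitions can have status \<open>None\<close>,
  and their dates did not change.\<close>

lemma restart_zero:
  assumes st: "(m, \<phi>) \<in> net_states N" and step: "discrete_step N (m, \<phi>) t (m', \<phi>')"
    and zero: "\<And>k. k \<in> enabled N m \<Longrightarrow> \<sigma> k = None \<Longrightarrow> \<phi> k = 0"
    and k: "restart m t \<sigma> k = None"
  shows "\<phi>' k = 0"
proof -
  have p: "k \<in> pers N m t" "\<sigma> k = None" using k by (auto simp: restart_def split: if_splits)
  then have "\<phi>' k = \<phi> k" using step unfolding discrete_step_N_iff[OF st] by blast
  then show ?thesis using zero p pers_enabled[of N m t] by auto
qed

text \<open>A firing of \<open>t\<close> is matched by at most one silent step, which expires the
  clock of \<open>t\<close>, followed by the visible copy; all other clocks may keep running. Delays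
  match delays.\<close>

lemma simulation_N_X:
  "weak_timed_simulation (state_graph N Some) (state_graph X ulabel) unfolding_rel"
  unfolding weak_timed_simulation_def
proof (intro allI impI)
  fix s1 s2 \<alpha> s1'
  assume "(s1, s2) \<in> unfolding_rel" and stp: "step (state_graph N Some) s1 \<alpha> s1'"
  then obtain m \<phi> \<sigma> where s: "s1 = (m, \<phi>)" "s2 = (config m \<sigma>, dates m \<sigma> \<phi>)"
    and re: "(m, \<phi>) \<in> reachable (state_graph N Some)" and adm: "admissible m \<sigma>"
    and zero: "\<And>k. k \<in> enabled N m \<Longrightarrow> \<sigma> k = None \<Longrightarrow> \<phi> k = 0"
    unfolding unfolding_rel_def by blast
  have st: "(m, \<phi>) \<in> net_states N" using re by (rule reachable_net_states)
  have re': "s1' \<in> reachable (state_graph N Some)"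
    using reachable_step[OF re] stp s by blast
  show "\<exists>s2'. wstep (state_graph X ulabel) s2 \<alpha> s2' \<and> (s1', s2') \<in> unfolding_rel"
  proof (cases \<alpha>)
    case Tau
    then show ?thesis using stp by (simp add: state_graph_def)
  next
    case (Act t)
    obtain m' \<phi>' where s1': "s1' = (m', \<phi>')" by (metis surj_pair)
    have step: "discrete_step N (m, \<phi>) t (m', \<phi>')"
      using stp Act s s1' by (simp add: state_graph_def)
    have m': "m' = fire N m t" and t: "t \<in> enabled N m" "\<phi> t = 0"
      using step unfolding discrete_step_N_iff[OF st] by blast+
    have M': "m' \<in> M" using re' s1' reachable_marking by blast
    \<comment> \<open>These are the statuses after the clock of \<open>t\<close> has expired; they
      equal \<open>\<sigma>\<close> if it had expired before.\<close>
    define \<sigma>1 where "\<sigma>1 = \<sigma>(t := None)"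
    have adm1: "admissible m \<sigma>1" unfolding \<sigma>1_def using adm by (rule admissible_upd)
    have zero1: "\<phi> k = 0" if "k \<in> enabled N m" "\<sigma>1 k = None" for k
      using that zero t by (auto simp: \<sigma>1_def split: if_splits)
    have tau: "(\<lambda>u v. step (state_graph X ulabel) u Tau v)\<^sup>*\<^sup>* s2 (config m \<sigma>1, dates m \<sigma>1 \<phi>)"
    proof (cases "\<sigma> t")
      case None
      then have "\<sigma>1 = \<sigma>" by (auto simp: \<sigma>1_def)
      then show ?thesis using s by simp
    next
      case (Some q)
      then have "discrete_step X s2 (Clock t q) (config m \<sigma>1, dates m \<sigma>1 \<phi>)"
        using discrete_step_Clock[OF adm st] t by (simp add: s \<sigma>1_def)
      then have "step (state_graph X ulabel) s2 Tau (config m \<sigma>1, dates m \<sigma>1 \<phi>)"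
        by (auto simp: state_graph_def intro!: exI[of _ "Clock t q"])
      then show ?thesis by blast
    qed
    let ?s2' = "(config m' (restart m t \<sigma>1), dates m' (restart m t \<sigma>1) \<phi>')"
    obtain \<rho> where
      "discrete_step X (config m \<sigma>1, dates m \<sigma>1 \<phi>) (Visible t m \<rho>) ?s2'"
      using Visible_of_discrete_step[OF adm1 st _ step M'] by (auto simp: \<sigma>1_def)
    then have "step (state_graph X ulabel) (config m \<sigma>1, dates m \<sigma>1 \<phi>) \<alpha> ?s2'"
      by (auto simp: Act state_graph_def intro!: exI[of _ "Visible t m \<rho>"])
    then have "wstep (state_graph X ulabel) s2 \<alpha> ?s2'"
      using tau Act unfolding wstep_def by auto
    moreover have "(s1', ?s2') \<in> unfolding_rel"
      unfolding s1'
    proof (rule unfolding_relI)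
      show "(m', \<phi>') \<in> reachable (state_graph N Some)" using re' s1' by simp
      show "admissible m' (restart m t \<sigma>1)" using admissible_restart adm1 M' m' by blast
      show "\<phi>' k = 0" if "restart m t \<sigma>1 k = None" for k
        using restart_zero[OF st step zero1 that] .
    qed
    ultimately show ?thesis by blast
  next
    case (Delay \<theta>)
    have d: "delay_step N (m, \<phi>) \<theta> s1'" using stp Delay s by (simp add: state_graph_def)
    then obtain \<phi>' where s1': "s1' = (m, \<phi>')" by (auto simp: delay_step_def)
    have "delay_step X s2 \<theta> (config m \<sigma>, dates m \<sigma> \<phi>')"
      unfolding s using delay_step_dates_iff[OF adm st zero closed_fire[OF re]] d s1' by blast
    then have "wstep (state_graph X ulabel) s2 \<alpha> (config m \<sigma>, dates m \<sigma> \<phi>')"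
      by (intro step_wstep) (simp add: Delay state_graph_def)
    moreover have "(s1', (config m \<sigma>, dates m \<sigma> \<phi>')) \<in> unfolding_rel"
      unfolding s1'
    proof (rule unfolding_relI)
      show "\<phi>' k = 0" if k: "k \<in> enabled N m" "\<sigma> k = None" for k
        using d k zero[OF k] by (force simp: delay_step_def s1')
    qed (use re' s1' adm in auto)
    ultimately show ?thesis by blast
  qed
qed

text \<open>A silent step is matched by staying put: a clock fires only at date zero, so the new
  status \<open>None\<close> still respects the relation.\<close>

lemma simulation_X_N:
  "weak_timed_simulation (state_graph X ulabel) (state_graph N Some) (unfolding_rel\<inverse>)"
  unfolding weak_timed_simulation_def
proof (intro allI impI)
  fix s2 s1 \<alpha> s2'
  assume "(s2, s1) \<in> unfolding_rel\<inverse>" and stp: "step (state_graph X ulabel) s2 \<alpha> s2'"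
  then obtain m \<phi> \<sigma> where s: "s1 = (m, \<phi>)" "s2 = (config m \<sigma>, dates m \<sigma> \<phi>)"
    and re: "(m, \<phi>) \<in> reachable (state_graph N Some)" and adm: "admissible m \<sigma>"
    and zero: "\<And>k. k \<in> enabled N m \<Longrightarrow> \<sigma> k = None \<Longrightarrow> \<phi> k = 0"
    unfolding unfolding_rel_def by blast
  have st: "(m, \<phi>) \<in> net_states N" using re by (rule reachable_net_states)
  show "\<exists>s1'. wstep (state_graph N Some) s1 \<alpha> s1' \<and> (s2', s1') \<in> unfolding_rel\<inverse>"
  proof (cases \<alpha>)
    case Tau
    then obtain u where u: "discrete_step X s2 u s2'" "ulabel u = None"
      using stp by (auto simp: state_graph_def)
    then obtain k q where "u = Clock k q" by (cases u) auto
    then have k: "\<phi> k = 0" "s2' = (config m (\<sigma>(k := None)), dates m (\<sigma>(k := None)) \<phi>)"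
      using u(1) discrete_step_Clock[OF adm st] by (simp_all add: s)
    have "(s1, s2') \<in> unfolding_rel"
      unfolding s k(2) using re admissible_upd[OF adm]
      by (rule unfolding_relI) (use zero k(1) in \<open>auto split: if_splits\<close>)
    moreover have "wstep (state_graph N Some) s1 \<alpha> s1" by (simp add: wstep_def Tau)
    ultimately show ?thesis by blast
  next
    case (Act t)
    then obtain u where u: "discrete_step X s2 u s2'" "ulabel u = Some t"
      using stp by (auto simp: state_graph_def)
    then obtain m1 \<rho> where "u = Visible t m1 \<rho>" by (cases u) auto
    then have "discrete_step X (config m \<sigma>, dates m \<sigma> \<phi>) (Visible t m1 \<rho>) s2'" using u s by simp
    then obtain \<phi>' where \<phi>': "discrete_step N (m, \<phi>) t (fire N m t, \<phi>')" "fire N m t \<in> M"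
      "s2' = (config (fire N m t) (restart m t \<sigma>), dates (fire N m t) (restart m t \<sigma>) \<phi>')"
      using discrete_step_of_Visible[OF adm st zero] by blast
    have "((fire N m t, \<phi>'), s2') \<in> unfolding_rel"
      unfolding \<phi>'(3)
    proof (rule unfolding_relI)
      show "\<phi>' k = 0" if "restart m t \<sigma> k = None" for k
        using restart_zero[OF st \<phi>'(1) zero that] .
    qed (use reachable_discrete_step[OF re \<phi>'(1)] admissible_restart[OF adm \<phi>'(2)] in auto)
    moreover have "wstep (state_graph N Some) s1 \<alpha> (fire N m t, \<phi>')"
      using \<phi>'(1) by (intro step_wstep) (simp add: Act state_graph_def s)
    ultimately show ?thesis by blast
  next
    case (Delay \<theta>)
    then have "delay_step X (config m \<sigma>, dates m \<sigma> \<phi>) \<theta> s2'"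
      using stp by (simp add: state_graph_def s)
    then obtain \<phi>' where d: "delay_step N (m, \<phi>) \<theta> (m, \<phi>')"
      and s2': "s2' = (config m \<sigma>, dates m \<sigma> \<phi>')"
      using delay_step_dates_iff[OF adm st zero closed_fire[OF re]] by blast
    have stp1: "step (state_graph N Some) (m, \<phi>) \<alpha> (m, \<phi>')"
      using d by (simp add: state_graph_def Delay)
    have "((m, \<phi>'), s2') \<in> unfolding_rel"
      unfolding s2'
    proof (rule unfolding_relI)
      show "\<phi>' k = 0" if k: "k \<in> enabled N m" "\<sigma> k = None" for k
        using d k zero[OF k] by (force simp: delay_step_def)
    qed (use reachable_step[OF re stp1] adm in auto)
    moreover have "wstep (state_graph N Some) s1 \<alpha> (m, \<phi>')"
      using stp1 s by (simp add: step_wstep)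
    ultimately show ?thesis by blast
  qed
qed

lemma weakly_timed_bisimilar_unfolded:
  "weakly_timed_bisimilar (state_graph N Some) (state_graph X ulabel)"
proof -
  let ?\<sigma> = "\<lambda>_::'t. Some (m0 N)"
  have adm: "admissible (m0 N) ?\<sigma>" using m0M by (simp add: admissible_def)
  have rel: "((m0 N, \<phi>), (config (m0 N) ?\<sigma>, dates (m0 N) ?\<sigma> \<phi>)) \<in> unfolding_rel"
    if "(m0 N, \<phi>) \<in> net_init N" for \<phi>
    using net_init_reachable[OF that] adm by (rule unfolding_relI) simp
  have sub: "unfolding_rel \<subseteq> net_states N \<times> net_states X"
    using dates_net_states reachable_net_states by (fastforce simp: unfolding_rel_def)
  have "\<exists>s2\<in>net_init X. (s1, s2) \<in> unfolding_rel" if s1N: "s1 \<in> net_init N" for s1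
  proof -
    obtain \<phi> where s1: "s1 = (m0 N, \<phi>)" using s1N by (cases s1) (auto simp: net_init_def)
    have "(config (m0 N) ?\<sigma>, dates (m0 N) ?\<sigma> \<phi>) \<in> net_states X"
      using s1N s1 dates_net_states[OF adm] by (auto simp: net_init_def)
    moreover have "dates (m0 N) ?\<sigma> \<phi> u \<in> Is X u mx" if "u \<in> enabled X (config (m0 N) ?\<sigma>)" for u mx
      using that s1N s1 enabled_Clock[OF adm]
      by (cases u) (auto simp: dates_def net_init_def)
    ultimately have "(config (m0 N) ?\<sigma>, dates (m0 N) ?\<sigma> \<phi>) \<in> net_init X"
      by (simp add: net_init_def m0_X)
    then show ?thesis using rel s1N s1 by blast
  qed
  moreover have "\<exists>s1\<in>net_init N. (s1, s2) \<in> unfolding_rel" if s2X: "s2 \<in> net_init X" for s2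
  proof -
    obtain \<phi>x where s2: "s2 = (config (m0 N) ?\<sigma>, \<phi>x)"
      using s2X by (cases s2) (auto simp: net_init_def m0_X)
    \<comment> \<open>Initially all clocks have been started at \<open>m0 N\<close>, so the dates of
      \<open>N\<close> can be read off them.\<close>
    define \<phi> where "\<phi> = (\<lambda>k\<in>enabled N (m0 N). \<phi>x (Clock k (m0 N)))"
    have stx: "(config (m0 N) ?\<sigma>, \<phi>x) \<in> net_states X" using s2X by (simp add: s2 net_init_def m0_X)
    have int: "\<phi>x u \<in> Is X u (m0 X)" if "u \<in> enabled X (config (m0 N) ?\<sigma>)" for u
      using that s2X s2 by (auto simp: net_init_def m0_X)
    have clk: "0 \<le> \<phi>x (Clock k (m0 N)) \<and> \<phi>x (Clock k (m0 N)) \<in> Is N k (m0 N)"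
      if "k \<in> enabled N (m0 N)" for k
    proof -
      have en: "Clock k (m0 N) \<in> enabled X (config (m0 N) ?\<sigma>)"
        using that by (simp add: enabled_Clock[OF adm])
      then show ?thesis using int[OF en] stx by (auto simp: net_states_def)
    qed
    have "\<phi>x = dates (m0 N) ?\<sigma> \<phi>"
      using int by (intro eq_datesI[OF adm stx]) (fastforce simp: \<phi>_def)+
    moreover have "(m0 N, \<phi>) \<in> net_init N"
      using clk m0M MN by (auto simp: net_init_def net_states_def \<phi>_def)
    ultimately show ?thesis using rel s2 by blast
  qed
  ultimately show ?thesis
    unfolding weakly_timed_bisimilar_def
    by (intro exI[of _ unfolding_rel] conjI simulation_N_X simulation_X_N)
      (use sub in \<open>auto simp: state_graph_def\<close>)
qed

section \<open>The unfolding is a finite standard Time Petri Net\<close>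

lemma finite_places_X: "finite (places X)"
proof -
  have "places X = Cur ` M \<union> (\<lambda>(k, s). Status k s) ` (transitions N \<times> insert None (Some ` M))"
    by (auto simp: unfolded_net_def)
  then show ?thesis using weak finM by (simp add: weak_dtpn_def is_dtpn_def)
qed

lemma finite_transitions_X: "finite (transitions X)"
proof -
  have fin: "finite (transitions N)" using weak by (simp add: weak_dtpn_def is_dtpn_def)
  then have "finite (enabled N m)" for m by (simp add: enabled_def)
  then have "finite (enabled N m \<rightarrow>\<^sub>E insert None (Some ` M))" for m
    using finM by (intro finite_PiE) auto
  then have "finite ((\<lambda>(k, q). Clock k q) ` (transitions N \<times> M) \<union>
      (\<Union>t\<in>transitions N. \<Union>m\<in>M. Visible t m ` (enabled N m \<rightarrow>\<^sub>E insert None (Some ` M))))"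
    using fin finM by blast
  moreover have "transitions X \<subseteq> (\<lambda>(k, q). Clock k q) ` (transitions N \<times> M) \<union>
      (\<Union>t\<in>transitions N. \<Union>m\<in>M. Visible t m ` (enabled N m \<rightarrow>\<^sub>E insert None (Some ` M)))"
  proof
    fix u assume "u \<in> transitions X"
    then show "u \<in> (\<lambda>(k, q). Clock k q) ` (transitions N \<times> M) \<union>
        (\<Union>t\<in>transitions N. \<Union>m\<in>M. Visible t m ` (enabled N m \<rightarrow>\<^sub>E insert None (Some ` M)))"
      by (cases u) (auto dest: enabled_transitions intro!: rev_image_eqI)
  qed
  ultimately show ?thesis by (rule rev_finite_subset)
qed

text \<open>The dependence on the marking has moved into the name of the transition:
  \<open>Clock k q\<close> always has the interval \<open>Is N k q\<close>, which is rational
  because \<open>q\<close> is a marking of \<open>N\<close>.\<close>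

lemma time_petri_net_unfolded: "time_petri_net X"
proof -
  have "{0} \<in> rat_intervals"
    unfolding rat_intervals_def by (rule UnI1) (auto intro!: exI[of _ 0])
  then have "Is X u mx \<in> rat_intervals" if "u \<in> transitions X" for u mx
    using that weak MN by (cases u) (auto simp: weak_dtpn_def is_dtpn_def)
  then have "is_dtpn X"
    using finite_places_X finite_transitions_X
    by (simp add: is_dtpn_def m0_X singleton_real_intervals)
  moreover have "Is X u mx = Is X u mx'" for u mx mx' by (cases u) simp_all
  ultimately show ?thesis by (simp add: time_petri_net_def weak_dtpn_def)
qed

lemma ulabel_transitions: "u \<in> transitions X \<Longrightarrow> ulabel u \<in> insert None (Some ` transitions N)"
  by (cases u) (auto simp: enabled_transitions)

end

theorem theorem1:
  fixes N :: "('p, 't) dtpn"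
  assumes "weak_dtpn N"
    and "finite (reachable_markings N)"
  shows "\<exists>(Nx :: (nat, nat) dtpn) (lab :: nat \<Rightarrow> 't option).
           time_petri_net Nx \<and>
           (\<forall>u\<in>transitions Nx. lab u \<in> insert None (Some ` transitions N)) \<and>
           weakly_timed_bisimilar (state_graph N Some) (state_graph Nx lab)"
proof -
  \<comment> \<open>Inserting \<open>m0 N\<close> places it in the set without exhibiting an initial
    state, and the set stays finite.\<close>
  let ?M = "insert (m0 N) (reachable_markings N)"
  have m0: "m0 N \<in> markings N" using assms(1) by (simp add: weak_dtpn_def is_dtpn_def)
  have "reachable_markings N \<subseteq> markings N"
    using reachable_net_states[of _ N] by (force simp: reachable_markings_def net_states_def)
  then interpret unfolding_markings N ?M
    using assms m0 by unfold_locales auto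
  \<comment> \<open>Finiteness of the unfolding gives injections of its places and transitions into
    the natural numbers, the types required of \<open>Nx\<close>; below, \<open>N'\<close> is the
    copy of \<open>X\<close> renamed along them.\<close>
  obtain e :: "('p, 't) uplace \<Rightarrow> nat" where e: "inj_on e (places X)"
    using finite_imp_inj_to_nat_seg[OF finite_places_X] by blast
  obtain f :: "('p, 't) utrans \<Rightarrow> nat" where f: "inj_on f (transitions X)"
    using finite_imp_inj_to_nat_seg[OF finite_transitions_X] by blast
  interpret renaming X e f using e f by unfold_locales
  have "weakly_timed_bisimilar (state_graph N Some)
      (state_graph N' (ulabel \<circ> inv_into (transitions X) f))"
    by (rule weakly_timed_bisimilar_renamed[OF weakly_timed_bisimilar_unfolded])
      (simp add: m0_X)
  moreover have "\<forall>u\<in>transitions N'. (ulabel \<circ> inv_into (transitions X) f) u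
      \<in> insert None (Some ` transitions N)"
    using ulabel_transitions f by simp
  ultimately show ?thesis using time_petri_net_renamed[OF time_petri_net_unfolded] by blast
qed

end
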